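(* Let $r\ge 2$ be an integer and let $\rho(x)$ be a proximate order with $\rho(x)\to\rho$ as $x\to\infty$, where $0<\rho<\infty$. Then there exists a function $g$ analytic in the unit disk $\mathbb D$ such that: (i) $g\in PF_r$; (ii) $g$ is of proximate order $\rho(x)$ in $\mathbb D$; (iii) $g$ is analytically extendable to $\overline{\mathbb C}\setminus\{1\}$ and has at $z=1$ an essential singularity of proximate order $\rho(x)$.
   Context: **$PF_r$.** For $r\in\mathbb N$, a real sequence $\{a_k\}_{k=0}^\infty$ belongs to $PF_r$ if all minors of order $\le r$ of the infinite upper triangular Toeplitz matrix $(a_{j-i})_{i,j\ge 0}$ (with $a_m:=0$ for $m<0$) are non-negative. The generating function $\sum_{k\ge0}a_kz^k$ of such a sequence is also said to belong to $PF_r$. **Proximate order.** A proximate order is a function $\rho(x):\mathbb R_+\to\mathbb R_+$ of class $C^1(\mathbb R_+)$ such that $\lim_{x\to\infty}\rho(x)=\rho$ with $0\le\rho<\infty$, and $\lim_{x\to\infty}x\frac{\rho'(x)}{\rho(x)}\log x=0$. Put $V(x)=x^{\rho(x)}$. Then $V$ is strictly increasing for large $x$; by convention $\rho(x)$ is redefined on a finite interval $[0,x_0)$ so that $V$ is strictly increasing on $\mathbb R_+$ with $V(0)=0$. **Growth in $\mathbb D$.** For $g$ analytic in $\mathbb D=\{|z|<1\}$ let $M(y,g)=\max_{|z|=y}|g(z)|$. The function $g$ is of proximate order $\rho(x)$ in $\mathbb D$ if $\limsup_{y\to1^-}\frac{\log M(y,g)}{V(1/(1-y))}$ is positive and finite.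 **Growth at the singularity.** For $g$ analytic in $\{0<|z-1|\le\varepsilon\}$ let $M_1(x,g)=\max_{1/x\le|z-1|\le\varepsilon}|g(z)|$, $x>1/\varepsilon$. The function $g$ has at $z=1$ a singularity of proximate order $\rho(x)$ if $\limsup_{x\to\infty}\frac{\log M_1(x,g)}{V(x)}$ is positive and finite. $\overline{\mathbb C}$ is the extended complex plane. *)

theory Defs
  imports
    "HOL-Complex_Analysis.Complex_Analysis"
    "Jordan_Normal_Form.Determinant"
begin

definition toeplitz :: "(nat \<Rightarrow> real) \<Rightarrow> nat \<Rightarrow> nat \<Rightarrow> real" where
  "toeplitz a i j = (if i \<le> j then a (j - i) else 0)"

text \<open>
  The minor of order \<open>k\<close> with rows \<open>I 0 < \<dots> < I (k - 1)\<close> and columns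
  \<open>J 0 < \<dots> < J (k - 1)\<close>. The order 0 minor is 1, so allowing \<open>k = 0\<close> below is harmless.
\<close>
definition toeplitz_minor ::
    "(nat \<Rightarrow> real) \<Rightarrow> nat \<Rightarrow> (nat \<Rightarrow> nat) \<Rightarrow> (nat \<Rightarrow> nat) \<Rightarrow> real" where
  "toeplitz_minor a k I J =
     Determinant.det (Matrix.mat k k (\<lambda>(p, q). toeplitz a (I p) (J q)))"

definition PF_seq :: "nat \<Rightarrow> (nat \<Rightarrow> real) \<Rightarrow> bool" where
  "PF_seq r a \<longleftrightarrow>
     (\<forall>k\<le>r. \<forall>I J. strict_mono_on {..<k} I \<longrightarrow> strict_mono_on {..<k} J \<longrightarrow>
        0 \<le> toeplitz_minor a k I J)"

definition PF_fun :: "nat \<Rightarrow> (complex \<Rightarrow> complex) \<Rightarrow> bool" where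
  "PF_fun r g \<longleftrightarrow>
     (\<exists>a. PF_seq r a \<and> (\<forall>z\<in>ball 0 1. (\<lambda>k. of_real (a k) * z ^ k) sums g z))"

text \<open>
  Here \<open>\<real>\<^sub>+\<close> is \<open>[0, \<infinity>)\<close>, with a one-sided derivative at 0.
  The customary normalisation (changing \<open>\<rho>\<close> on a bounded interval so that
  \<open>x powr \<rho> x\<close> is strictly increasing) is not imposed: the growth notions
  below depend only on the values of \<open>\<rho>\<close> near infinity, so it does not affect them.
\<close>
definition proximate_order :: "(real \<Rightarrow> real) \<Rightarrow> bool" where
  "proximate_order \<rho> \<longleftrightarrow>
     (\<forall>x\<ge>0. 0 \<le> \<rho> x) \<and>
     (\<exists>l\<ge>0. (\<rho> \<longlongrightarrow> l) at_top) \<and>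
     (\<exists>\<rho>'. (\<forall>x\<ge>0. (\<rho> has_real_derivative \<rho>' x) (at x within {0..})) \<and>
           continuous_on {0..} \<rho>' \<and>
           ((\<lambda>x. x * (\<rho>' x / \<rho> x) * ln x) \<longlongrightarrow> 0) at_top)"

definition prox_V :: "(real \<Rightarrow> real) \<Rightarrow> real \<Rightarrow> real" where
  "prox_V \<rho> x = x powr \<rho> x"

definition max_mod :: "(complex \<Rightarrow> complex) \<Rightarrow> complex set \<Rightarrow> real" where
  "max_mod g S = (SUP z\<in>S. cmod (g z))"

definition has_proximate_order_disk ::
    "(complex \<Rightarrow> complex) \<Rightarrow> (real \<Rightarrow> real) \<Rightarrow> bool" where
  "has_proximate_order_disk g \<rho> \<longleftrightarrow>
     g holomorphic_on ball 0 1 \<and>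
     (let L = Limsup (at_left (1::real))
                (\<lambda>y. ereal (ln (max_mod g (sphere 0 y)) / prox_V \<rho> (1 / (1 - y))))
      in 0 < L \<and> L < \<infinity>)"

text \<open>
  The choice of \<open>\<epsilon>\<close> is immaterial when \<open>\<rho>\<close> has a positive limit,
  since then the denominator tends to infinity.
\<close>
definition has_singularity_of_proximate_order_at_1 ::
    "(complex \<Rightarrow> complex) \<Rightarrow> (real \<Rightarrow> real) \<Rightarrow> bool" where
  "has_singularity_of_proximate_order_at_1 g \<rho> \<longleftrightarrow>
     (\<exists>\<epsilon>>0. g analytic_on {z. 0 < cmod (z - 1) \<and> cmod (z - 1) \<le> \<epsilon>} \<and>
       (let L = Limsup at_top
                  (\<lambda>x. ereal (ln (max_mod g {z. 1 / x \<le> cmod (z - 1) \<and> cmod (z - 1) \<le> \<epsilon>})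
                              / prox_V \<rho> x))
        in 0 < L \<and> L < \<infinity>))"

definition analytic_at_infinity :: "(complex \<Rightarrow> complex) \<Rightarrow> bool" where
  "analytic_at_infinity G \<longleftrightarrow>
     (\<exists>H. H analytic_on {0} \<and> (\<forall>\<^sub>F w in at 0. H w = G (inverse w)))"

definition essential_singularity_at :: "(complex \<Rightarrow> complex) \<Rightarrow> complex \<Rightarrow> bool" where
  "essential_singularity_at G z \<longleftrightarrow> isolated_singularity_at G z \<and> \<not> not_essential G z"

end

theory Submission imports Defs begin

text \<open>
  Put \<open>w = 1 / (1 - z)\<close>. The function sought is \<open>g(z) = w\<^sup>r \<psi>(w - 1)\<close>, where \<open>\<psi>\<close> is
  entire with a \<open>PF\<^sub>r\<close> coefficient sequence \<open>b\<close> and \<open>ln \<psi>(x)\<close> is comparable to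
  \<open>V(x) = x powr \<rho> x\<close>. Since \<open>w - 1 = z / (1 - z)\<close> is regular on the Riemann sphere except
  for a pole at 1, so is \<open>g\<close> except for a singularity at 1. As the coefficients are non-negative,
  the maximum modulus of \<open>g\<close> on a circle is attained on the positive axis, and \<open>\<psi>\<close> there
  determines both growth conditions; a growth faster than every power makes the singularity
  essential. What has to be explained is why \<open>g\<close> is \<open>PF\<^sub>r\<close> and why \<open>\<psi>\<close> exists.

  Both parts rest on a criterion of Fekete type: if every minor of order at most \<open>r\<close> with
  consecutive rows and consecutive columns whose diagonal entry lies in the support of the
  sequence is strictly positive, then the sequence is \<open>PF\<^sub>r\<close>
  (\<open>PF_seq_if_consecutive_minors_pos\<close> and its variant for sequences of finite support).

  For \<open>g\<close>, let \<open>N = r - 1\<close>. The Taylor coefficients are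
  \<open>a k = (\<Sum>m. b m * (k + N choose m + N))\<close>, and the Vandermonde convolution gives
  \<open>a (j - i) = (\<Sum>l t. (N - i choose N - l) * b (t - l) * (j choose t))\<close> as long as \<open>i \<le> N\<close>.
  So the first \<open>r\<close> rows of the Toeplitz matrix of \<open>a\<close> are a product of two Pascal matrices
  and the Toeplitz matrix of \<open>b\<close>, and the Cauchy--Binet formula makes their minors non-negative;
  one of the summands is strictly positive when the columns are consecutive. Consecutive
  minors only need these rows, so Fekete's criterion applies (\<open>PF_seq_binomial_transform\<close>).

  The function \<open>\<psi>\<close> is the product over \<open>j\<close> of \<open>P\<^sub>j (v / y\<^sub>j)\<close> with \<open>y\<^sub>j = Y * 2\<^sup>j\<close>,
  where \<open>P\<^sub>j\<close> is a \<open>PF\<^sub>r\<close> polynomial of degree about \<open>V(y\<^sub>j)\<close> with value 1 at 0. For orders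
  \<open>l > 1\<close> such a product converges only if the linear coefficients stay small although the
  degrees grow like \<open>y\<^sub>j\<close> to the power \<open>l\<close>; this rules out polynomials with real zeros.
  Polynomials of arbitrary degree \<open>d\<close> with extreme coefficients 1 and \<open>k\<close>-th coefficient at
  most \<open>r ^ k\<close> are provided by
  \<open>a k = (\<Prod>i=1..<r. sin (\<theta> * (k + i)) / sin (\<theta> * i))\<close> with \<open>\<theta> = pi / (d + r)\<close>, a
  trigonometric analogue of \<open>k + r - 1 choose r - 1\<close>. This expression vanishes at the \<open>r - 1\<close>
  integers on either side of \<open>0..d\<close>, hence the consecutive minors do not notice that the
  sequence is cut off, and they factor into sines
  (\<open>sine_product_det_pos\<close>, \<open>PF_polynomial_small_linear_term\<close>).
\<close>

section \<open>Determinants of matrices given by functions\<close>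

abbreviation det_fun :: "nat \<Rightarrow> (nat \<Rightarrow> nat \<Rightarrow> real) \<Rightarrow> real" where
  "det_fun k M \<equiv> Determinant.det (Matrix.mat k k (\<lambda>(p, q). M p q))"

lemma det_fun_cong:
  assumes "\<And>p q. p < k \<Longrightarrow> q < k \<Longrightarrow> M p q = M' p q"
  shows "det_fun k M = det_fun k M'"
  by (rule arg_cong[of _ _ Determinant.det], rule eq_matI) (auto simp: assms)

lemma permutes_lessThan: "s permutes {..<k} \<Longrightarrow> p < k \<Longrightarrow> s p < k"
  using permutes_in_image[of s "{..<k}" p] by simp

lemma det_fun_Leibniz:
  "det_fun k M = (\<Sum>s | s permutes {..<k}. signof s * (\<Prod>p<k. M p (s p)))"
proof -
  have "det_fun k M = (\<Sum>s | s permutes {0..<k}. signof s *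
      (\<Prod>p=0..<k. Matrix.mat k k (\<lambda>(p, q). M p q) $$ (p, s p)))"
    by (rule det_def') auto
  also have "\<dots> = (\<Sum>s | s permutes {0..<k}. signof s * (\<Prod>p=0..<k. M p (s p)))"
    by (intro sum.cong refl arg_cong2[of _ _ _ _ "(*)"] prod.cong) (auto simp: atLeast0LessThan intro: permutes_lessThan)
  finally show ?thesis by (simp add: atLeast0LessThan)
qed

lemma det_fun_transpose: "det_fun k (\<lambda>p q. M q p) = det_fun k M"
proof -
  have "det_fun k M = Determinant.det (Matrix.transpose_mat (Matrix.mat k k (\<lambda>(p, q). M p q)))"
    by (subst det_transpose[of _ k]) auto
  also have "\<dots> = det_fun k (\<lambda>p q. M q p)"
    by (rule arg_cong[of _ _ Determinant.det], rule eq_matI) auto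
  finally show ?thesis by simp
qed

lemma det_fun_scale: "det_fun k (\<lambda>p q. u p * v q * M p q) = (\<Prod>p<k. u p) * (\<Prod>p<k. v p) * det_fun k M"
proof -
  have "(\<Prod>p<k. u p * v (s p) * M p (s p)) = (\<Prod>p<k. u p) * (\<Prod>p<k. v p) * (\<Prod>p<k. M p (s p))"
    if "s permutes {..<k}" for s
  proof -
    have "(\<Prod>p<k. v (s p)) = (\<Prod>p<k. v p)"
      by (rule prod.permute[OF that, symmetric, unfolded comp_def])
    thus ?thesis by (simp add: prod.distrib)
  qed
  thus ?thesis by (simp add: det_fun_Leibniz sum_distrib_left mult_ac)
qed

text \<open>
  Multilinearity in the rows, with a separate index set for every row.
\<close>
lemma det_fun_rows_sum:
  assumes "\<And>p. p < k \<Longrightarrow> finite (S p)"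
  shows "det_fun k (\<lambda>p q. \<Sum>s\<in>S p. R p s q) = (\<Sum>f\<in>PiE {..<k} S. det_fun k (\<lambda>p q. R p (f p) q))"
proof -
  have "(\<Prod>p<k. \<Sum>s\<in>S p. R p s (t p)) = (\<Sum>f\<in>PiE {..<k} S. \<Prod>p<k. R p (f p) (t p))" for t
    by (rule prod_sum_PiE) (use assms in auto)
  hence "det_fun k (\<lambda>p q. \<Sum>s\<in>S p. R p s q) =
     (\<Sum>t | t permutes {..<k}. \<Sum>f\<in>PiE {..<k} S. signof t * (\<Prod>p<k. R p (f p) (t p)))"
    by (simp add: det_fun_Leibniz sum_distrib_left)
  also have "\<dots> = (\<Sum>f\<in>PiE {..<k} S. det_fun k (\<lambda>p q. R p (f p) q))"
    by (subst sum.swap) (simp add: det_fun_Leibniz)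
  finally show ?thesis .
qed

lemma det_fun_identical_rows:
  assumes "p < k" "p' < k" "p \<noteq> p'" "\<And>q. q < k \<Longrightarrow> M p q = M p' q"
  shows "det_fun k M = 0"
  by (rule det_identical_rows[of _ k p p']) (use assms in auto)

lemma det_fun_permute_rows:
  assumes "s permutes {..<k}"
  shows "det_fun k (\<lambda>p q. M (s p) q) = signof s * det_fun k M"
proof -
  have "det_fun k (\<lambda>p q. M (s p) q) =
      Determinant.det (Matrix.mat k k (\<lambda>(p, q). Matrix.mat k k (\<lambda>(p, q). M p q) $$ (s p, q)))"
    by (rule arg_cong[of _ _ Determinant.det], rule eq_matI)
       (use assms in \<open>auto simp: permutes_lessThan\<close>)
  also have "\<dots> = signof s * det_fun k M"
    by (rule det_permute_rows) (use assms in \<open>auto simp: atLeast0LessThan\<close>)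
  finally show ?thesis .
qed

lemma strict_mono_on_unique:
  fixes g h :: "nat \<Rightarrow> nat"
  assumes "strict_mono_on {..<m} g" "strict_mono_on {..<m} h" "g ` {..<m} = h ` {..<m}" "p < m"
  shows "g p = h p"
proof -
  have "sorted (map g [0..<m]) \<and> distinct (map g [0..<m])"
    if "strict_mono_on {..<m} g" for g :: "nat \<Rightarrow> nat"
    using that by (auto simp: sorted_iff_nth_mono distinct_map atLeast0LessThan strict_mono_on_imp_inj_on
        intro: strict_mono_on_leD)
  hence "map g [0..<m] = map h [0..<m]"
    using assms by (intro sorted_distinct_set_unique) (auto simp: atLeast0LessThan)
  thus ?thesis using assms(4) by (metis map_upt_eqI nth_map_upt add_0 diff_zero)
qed

definition incr_maps :: "nat \<Rightarrow> nat \<Rightarrow> (nat \<Rightarrow> nat) set" where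
  "incr_maps m n = {f \<in> PiE {..<m} (\<lambda>_. {..<n}). strict_mono_on {..<m} f}"

lemma finite_incr_maps [simp]: "finite (incr_maps m n)"
  unfolding incr_maps_def by (rule finite_subset[of _ "PiE {..<m} (\<lambda>_. {..<n})"]) (auto intro: finite_PiE)

text \<open>
  An injective choice of indices is sorted in exactly one way; this is the reindexing behind
  the Cauchy--Binet formula.
\<close>
lemma bij_betw_incr_maps_permutations:
  "bij_betw (\<lambda>(g, s). restrict (g \<circ> s) {..<m}) (incr_maps m n \<times> {s. s permutes {..<m}})
     {f \<in> PiE {..<m} (\<lambda>_. {..<n}). inj_on f {..<m}}"
proof (rule bij_betwI')
  fix x y assume "x \<in> incr_maps m n \<times> {s. s permutes {..<m}}" "y \<in> incr_maps m n \<times> {s. s permutes {..<m}}"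
  then obtain g s h t where x: "x = (g, s)" "g \<in> incr_maps m n" "s permutes {..<m}"
    and y: "y = (h, t)" "h \<in> incr_maps m n" "t permutes {..<m}" by auto
  show "(case x of (g, s) \<Rightarrow> restrict (g \<circ> s) {..<m}) = (case y of (g, s) \<Rightarrow> restrict (g \<circ> s) {..<m})
      \<longleftrightarrow> x = y"
  proof
    assume "(case x of (g, s) \<Rightarrow> restrict (g \<circ> s) {..<m}) = (case y of (g, s) \<Rightarrow> restrict (g \<circ> s) {..<m})"
    hence "restrict (g \<circ> s) {..<m} p = restrict (h \<circ> t) {..<m} p" for p by (simp add: x y)
    hence eq: "g (s p) = h (t p)" if "p < m" for p
      using that by (metis comp_apply lessThan_iff restrict_apply')
    have "g ` {..<m} = (\<lambda>p. g (s p)) ` {..<m}" using permutes_image[OF x(3)] by (metis image_image)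
    also have "\<dots> = (\<lambda>p. h (t p)) ` {..<m}" using eq by auto
    also have "\<dots> = h ` {..<m}" using permutes_image[OF y(3)] by (metis image_image)
    finally have gh: "g p = h p" if "p < m" for p
      using that x(2) y(2) strict_mono_on_unique[of m g h p] by (auto simp: incr_maps_def)
    have "g = h"
      by (rule extensionalityI[of g "{..<m}" h])
         (use x(2) y(2) gh in \<open>auto simp: incr_maps_def PiE_def\<close>)
    moreover have "s = t"
    proof
      fix p
      show "s p = t p"
      proof (cases "p < m")
        case True
        have "inj_on g {..<m}" using x(2) by (auto simp: incr_maps_def strict_mono_on_imp_inj_on)
        moreover have "g (s p) = g (t p)" using eq[OF True] \<open>g = h\<close> by simp
        moreover have "s p \<in> {..<m}" "t p \<in> {..<m}"
          using True x(3) y(3) by (auto simp: permutes_lessThan)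
        ultimately show ?thesis by (auto dest: inj_onD)
      next
        case False
        thus ?thesis using x(3) y(3) by (simp add: permutes_not_in)
      qed
    qed
    ultimately show "x = y" by (simp add: x y)
  qed auto
next
  fix x assume "x \<in> incr_maps m n \<times> {s. s permutes {..<m}}"
  then obtain g s where x: "x = (g, s)" "g \<in> incr_maps m n" "s permutes {..<m}" by auto
  have s: "s p < m" if "p < m" for p using x(3) that permutes_in_image[OF x(3)] by (auto simp only: lessThan_iff)
  have g: "g p < n" if "p < m" for p using x(2) that by (auto simp: incr_maps_def)
  have "inj_on g {..<m}" using x(2) by (auto simp: incr_maps_def strict_mono_on_imp_inj_on)
  hence "inj_on (g \<circ> s) {..<m}"
    using s by (auto simp: inj_on_def dest: permutes_inj[OF x(3), THEN injD])
  thus "(case x of (g, s) \<Rightarrow> restrict (g \<circ> s) {..<m}) \<in> {f \<in> PiE {..<m} (\<lambda>_. {..<n}). inj_on f {..<m}}"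
    using s g by (auto simp: x inj_on_def)
next
  fix f assume "f \<in> {f \<in> PiE {..<m} (\<lambda>_. {..<n}). inj_on f {..<m}}"
  hence f: "f \<in> PiE {..<m} (\<lambda>_. {..<n})" "inj_on f {..<m}" by auto
  have card: "card (f ` {..<m}) = m" using f(2) by (simp add: card_image)
  obtain h where h: "bij_betw h {..<m} (f ` {..<m})" "strict_mono_on {..<m} h"
    using ex_bij_betw_strict_mono_card[of "f ` {..<m}"] card by auto
  define s where "s p = (if p < m then the_inv_into {..<m} h (f p) else p)" for p
  have inv: "bij_betw (the_inv_into {..<m} h) (f ` {..<m}) {..<m}"
    by (rule bij_betw_the_inv_into[OF h(1)])
  have hs: "h (s p) = f p" if "p < m" for p
    using f_the_inv_into_f_bij_betw[OF h(1), of "f p"] that by (auto simp: s_def)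
  have "bij_betw (the_inv_into {..<m} h \<circ> f) {..<m} {..<m}"
    using f(2) inv by (intro bij_betw_trans) (auto simp: bij_betw_def)
  hence "bij_betw s {..<m} {..<m}"
    by (rule bij_betw_cong[THEN iffD1, rotated]) (auto simp: s_def)
  hence sp: "s permutes {..<m}" by (rule bij_imp_permutes) (auto simp: s_def)
  have "h p < n" if "p < m" for p
  proof -
    have "h p \<in> f ` {..<m}" using bij_betwE[OF h(1)] that by simp
    then obtain q where "q \<in> {..<m}" "h p = f q" by blast
    thus ?thesis using PiE_mem[OF f(1), of q] by simp
  qed
  hence h_incr: "restrict h {..<m} \<in> incr_maps m n"
    using h(2) by (auto simp: incr_maps_def strict_mono_on_def)
  have "f p = restrict (restrict h {..<m} \<circ> s) {..<m} p" for p
  proof (cases "p < m")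
    case True
    thus ?thesis using hs[of p] permutes_lessThan[OF sp, of p] by simp
  next
    case False
    thus ?thesis using PiE_arb[OF f(1), of p] by simp
  qed
  hence "f = restrict (restrict h {..<m} \<circ> s) {..<m}" by blast
  thus "\<exists>x\<in>incr_maps m n \<times> {s. s permutes {..<m}}. f = (case x of (g, s) \<Rightarrow> restrict (g \<circ> s) {..<m})"
    using sp h_incr by (intro bexI[of _ "(restrict h {..<m}, s)"]) simp_all
qed

text \<open>
  Expanding the rows of the product gives a sum over all choices of one summation index per row.
  Choices with a repeated index contribute nothing, and each of the others is an increasing
  choice followed by a permutation, whose sign reassembles the determinant of the first factor.
\<close>
theorem Cauchy_Binet:
  "det_fun m (\<lambda>p q. \<Sum>s<n. A p s * B s q) =
     (\<Sum>f\<in>incr_maps m n. det_fun m (\<lambda>p q. A p (f q)) * det_fun m (\<lambda>p q. B (f p) q))"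
proof -
  let ?E = "PiE {..<m} (\<lambda>_. {..<n})"
  let ?t = "\<lambda>f. (\<Prod>p<m. A p (f p)) * det_fun m (\<lambda>p q. B (f p) q)"
  have "det_fun m (\<lambda>p q. \<Sum>s<n. A p s * B s q) = (\<Sum>f\<in>?E. det_fun m (\<lambda>p q. A p (f p) * 1 * B (f p) q))"
    by (subst det_fun_rows_sum) auto
  also have "\<dots> = (\<Sum>f\<in>?E. ?t f)"
    by (subst det_fun_scale) simp
  also have "\<dots> = (\<Sum>f\<in>{f \<in> ?E. inj_on f {..<m}}. ?t f)"
  proof (rule sum.mono_neutral_right)
    show "finite ?E" by (auto intro: finite_PiE)
    show "\<forall>f\<in>?E - {f \<in> ?E. inj_on f {..<m}}. ?t f = 0"
    proof
      fix f assume "f \<in> ?E - {f \<in> ?E. inj_on f {..<m}}"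
      then obtain p p' where "p < m" "p' < m" "p \<noteq> p'" "f p = f p'" by (auto simp: inj_on_def)
      hence "det_fun m (\<lambda>p q. B (f p) q) = 0" by (intro det_fun_identical_rows[of p m p']) auto
      thus "?t f = 0" by simp
    qed
  qed auto
  also have "\<dots> = (\<Sum>(g, s)\<in>incr_maps m n \<times> {s. s permutes {..<m}}. ?t (restrict (g \<circ> s) {..<m}))"
    by (subst sum.reindex_bij_betw[OF bij_betw_incr_maps_permutations, symmetric])
       (simp add: case_prod_unfold)
  also have "\<dots> = (\<Sum>g\<in>incr_maps m n. \<Sum>s | s permutes {..<m}. ?t (restrict (g \<circ> s) {..<m}))"
    by (rule sum.cartesian_product[symmetric])
  also have "\<dots> = (\<Sum>g\<in>incr_maps m n. det_fun m (\<lambda>p q. A p (g q)) * det_fun m (\<lambda>p q. B (g p) q))"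
  proof (rule sum.cong[OF refl])
    fix g
    have "?t (restrict (g \<circ> s) {..<m}) =
        signof s * (\<Prod>p<m. A p (g (s p))) * det_fun m (\<lambda>p q. B (g p) q)" if "s permutes {..<m}" for s
    proof -
      have "det_fun m (\<lambda>p q. B (restrict (g \<circ> s) {..<m} p) q) = det_fun m (\<lambda>p q. B (g (s p)) q)"
        by (rule det_fun_cong) auto
      also have "\<dots> = signof s * det_fun m (\<lambda>p q. B (g p) q)"
        by (rule det_fun_permute_rows[OF that, where M = "\<lambda>p q. B (g p) q"])
      finally show ?thesis by simp
    qed
    hence "(\<Sum>s | s permutes {..<m}. ?t (restrict (g \<circ> s) {..<m})) =
        (\<Sum>s | s permutes {..<m}. signof s * (\<Prod>p<m. A p (g (s p))) * det_fun m (\<lambda>p q. B (g p) q))"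
      by (intro sum.cong) auto
    thus "(\<Sum>s | s permutes {..<m}. ?t (restrict (g \<circ> s) {..<m})) =
        det_fun m (\<lambda>p q. A p (g q)) * det_fun m (\<lambda>p q. B (g p) q)"
      by (simp add: det_fun_Leibniz[where M = "\<lambda>p q. A p (g q)"] sum_distrib_right)
  qed
  finally show ?thesis .
qed

lemma det_fun_mult: "det_fun m (\<lambda>p q. \<Sum>s<m. A p s * B s q) = det_fun m A * det_fun m B"
proof -
  have "det_fun m A * det_fun m B =
      Determinant.det (Matrix.mat m m (\<lambda>(p, q). A p q) * Matrix.mat m m (\<lambda>(p, q). B p q))"
    by (rule det_mult[symmetric]) auto
  also have "\<dots> = det_fun m (\<lambda>p q. \<Sum>s<m. A p s * B s q)"
    by (rule arg_cong[of _ _ Determinant.det], rule eq_matI)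
       (auto simp: scalar_prod_def atLeast0LessThan)
  finally show ?thesis by simp
qed

lemma det_fun_upper_triangular:
  assumes "\<And>p q. q < p \<Longrightarrow> p < m \<Longrightarrow> M p q = 0"
  shows "det_fun m M = (\<Prod>p<m. M p p)"
proof -
  have "det_fun m M = prod_list (diag_mat (Matrix.mat m m (\<lambda>(p, q). M p q)))"
    by (rule det_upper_triangular[of _ m]) (auto simp: upper_triangular_def assms)
  also have "diag_mat (Matrix.mat m m (\<lambda>(p, q). M p q)) = map (\<lambda>p. M p p) [0..<m]"
    by (auto simp: diag_mat_def)
  also have "prod_list (map (\<lambda>p. M p p) [0..<m]) = (\<Prod>p\<in>set [0..<m]. M p p)"
    by (rule prod.distinct_set_conv_list[OF distinct_upt, symmetric])
  also have "set [0..<m] = {..<m}" by auto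
  finally show ?thesis .
qed

lemma det_fun_lower_triangular:
  assumes "\<And>p q. p < q \<Longrightarrow> q < m \<Longrightarrow> M p q = 0"
  shows "det_fun m M = (\<Prod>p<m. M p p)"
proof -
  have "det_fun m M = det_fun m (\<lambda>p q. M q p)" by (rule det_fun_transpose[symmetric])
  also have "\<dots> = (\<Prod>p<m. M p p)" by (rule det_fun_upper_triangular) (rule assms)
  finally show ?thesis .
qed

lemma det_fun_first_column:
  assumes "\<And>p. p < m \<Longrightarrow> M (Suc p) 0 = 0"
  shows "det_fun (Suc m) M = M 0 0 * det_fun m (\<lambda>p q. M (Suc p) (Suc q))"
proof -
  define A where "A = Matrix.mat (Suc m) (Suc m) (\<lambda>(p, q). M p q)"
  have A: "A \<in> carrier_mat (Suc m) (Suc m)" by (auto simp: A_def)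
  have "Determinant.det A = (\<Sum>i<Suc m. A $$ (i, 0) * cofactor A i 0)"
    by (rule laplace_expansion_column[OF A]) simp
  also have "\<dots> = A $$ (0, 0) * cofactor A 0 0 + (\<Sum>i<m. A $$ (Suc i, 0) * cofactor A (Suc i) 0)"
    by (rule sum.lessThan_Suc_shift)
  also have "(\<Sum>i<m. A $$ (Suc i, 0) * cofactor A (Suc i) 0) = 0"
    by (rule sum.neutral) (auto simp: A_def assms)
  also have "cofactor A 0 0 = det_fun m (\<lambda>p q. M (Suc p) (Suc q))"
    unfolding cofactor_def mat_delete_def
    by simp (rule arg_cong[of _ _ Determinant.det], rule eq_matI, auto simp: A_def)
  finally show ?thesis by (simp add: A_def)
qed

text \<open>
  One elimination step on the first column that uses neighbouring rows only. Since the
  multipliers \<open>u\<close> and \<open>v\<close> are free, it covers differences of rows as well as the trigonometric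
  combinations needed for the determinants of sines below.
\<close>
lemma det_fun_eliminate:
  assumes "\<And>p. p < m \<Longrightarrow> u p * M (Suc p) 0 = v p * M p 0"
  shows "(\<Prod>p<m. u p) * det_fun (Suc m) M =
           M 0 0 * det_fun m (\<lambda>p q. u p * M (Suc p) (Suc q) - v p * M p (Suc q))"
proof -
  define L where "L p q = (if p = q then (case p of 0 \<Rightarrow> 1 | Suc p' \<Rightarrow> u p')
      else if p = Suc q then - v q else 0)" for p q
  define N where "N p q = (case p of 0 \<Rightarrow> M 0 q | Suc p' \<Rightarrow> u p' * M (Suc p') q - v p' * M p' q)" for p q
  have LM: "(\<Sum>s<Suc m. L p s * M s q) = N p q" if p: "p < Suc m" for p q
  proof (cases p)
    case 0
    have "(\<Sum>s<Suc m. L p s * M s q) = (\<Sum>s\<in>{0}. L p s * M s q)"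
      by (rule sum.mono_neutral_right) (auto simp: L_def 0)
    thus ?thesis by (simp add: 0 N_def L_def)
  next
    case (Suc p')
    have "(\<Sum>s<Suc m. L p s * M s q) = (\<Sum>s\<in>{p', Suc p'}. L p s * M s q)"
      by (rule sum.mono_neutral_right) (use p in \<open>auto simp: L_def Suc\<close>)
    thus ?thesis by (simp add: Suc N_def L_def)
  qed
  have "det_fun (Suc m) L = (\<Prod>p<Suc m. L p p)"
    by (rule det_fun_lower_triangular) (auto simp: L_def)
  also have "\<dots> = (\<Prod>p<m. u p)"
    by (subst prod.lessThan_Suc_shift) (simp add: L_def)
  finally have "(\<Prod>p<m. u p) * det_fun (Suc m) M = det_fun (Suc m) (\<lambda>p q. \<Sum>s<Suc m. L p s * M s q)"
    by (simp only: det_fun_mult)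
  also have "\<dots> = det_fun (Suc m) N" by (rule det_fun_cong) (rule LM)
  also have "\<dots> = N 0 0 * det_fun m (\<lambda>p q. N (Suc p) (Suc q))"
    by (rule det_fun_first_column) (simp add: N_def assms)
  finally show ?thesis by (simp add: N_def)
qed

text \<open>
  With a column of ones, differences of neighbouring rows telescope into sums of unit steps. The
  determinant becomes a sum over points interlacing the given ones of determinants of smaller
  order. This reduces arbitrary points to consecutive ones.
\<close>
lemma det_fun_ones_column:
  fixes X :: "nat \<Rightarrow> nat"
  assumes X: "strict_mono_on {..<Suc m} X"
    and "\<And>p. p \<le> m \<Longrightarrow> M p 0 = 1" and "\<And>p q. p \<le> m \<Longrightarrow> q < m \<Longrightarrow> M p (Suc q) = F (X p) q"
  shows "det_fun (Suc m) M =
    (\<Sum>f\<in>PiE {..<m} (\<lambda>p. {X p..<X (Suc p)}). det_fun m (\<lambda>p q. F (Suc (f p)) q - F (f p) q))"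
proof -
  have "det_fun (Suc m) M = det_fun m (\<lambda>p q. M (Suc p) (Suc q) - M p (Suc q))"
    using det_fun_eliminate[of m "\<lambda>_. 1" M "\<lambda>_. 1"] assms(2) by simp
  also have "\<dots> = det_fun m (\<lambda>p q. \<Sum>y\<in>{X p..<X (Suc p)}. F (Suc y) q - F y q)"
  proof (rule det_fun_cong)
    fix p q assume "p < m" "q < m"
    moreover from \<open>p < m\<close> have "X p \<le> X (Suc p)" by (intro strict_mono_on_leD[OF X]) auto
    ultimately show "M (Suc p) (Suc q) - M p (Suc q) = (\<Sum>y\<in>{X p..<X (Suc p)}. F (Suc y) q - F y q)"
      using sum_Suc_diff'[of "X p" "X (Suc p)" "\<lambda>y. F y q"] by (simp add: assms(2,3))
  qed
  also have "\<dots> = (\<Sum>f\<in>PiE {..<m} (\<lambda>p. {X p..<X (Suc p)}). det_fun m (\<lambda>p q. F (Suc (f p)) q - F (f p) q))"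
    by (rule det_fun_rows_sum) simp
  finally show ?thesis .
qed

section \<open>Fekete's criterion\<close>

lemma strict_mono_on_lessThanI:
  fixes f :: "nat \<Rightarrow> nat"
  assumes "\<And>p. Suc p < m \<Longrightarrow> f p < f (Suc p)"
  shows "strict_mono_on {..<m} f"
proof (rule strict_mono_onI)
  fix p q assume "p \<in> {..<m}" "q \<in> {..<m}" "p < q"
  from \<open>p < q\<close> \<open>q \<in> {..<m}\<close> show "f p < f q"
  proof (induction q)
    case (Suc q)
    have "f q < f (Suc q)" using Suc.prems by (intro assms) auto
    thus ?case using Suc by (cases "p = q") auto
  qed simp
qed

lemma interlacing_strict_mono:
  fixes X :: "nat \<Rightarrow> nat"
  assumes "f \<in> PiE {..<m} (\<lambda>p. {X p..<X (Suc p)})"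
  shows "strict_mono_on {..<m} f"
proof (rule strict_mono_on_lessThanI)
  fix p assume "Suc p < m"
  hence "f p \<in> {X p..<X (Suc p)}" "f (Suc p) \<in> {X (Suc p)..<X (Suc (Suc p))}"
    using PiE_mem[OF assms, of p] PiE_mem[OF assms, of "Suc p"] by auto
  thus "f p < f (Suc p)" by auto
qed

text \<open>
  Only minors on the first \<open>k\<close> coordinates enter, so one coordinate can be removed at a time:
  dividing by the positive coordinate 0 turns it into a column of ones, and \<open>det_fun_ones_column\<close>
  expresses minors of order \<open>k\<close> of \<open>F\<close> through minors of order \<open>k - 1\<close> of the differences \<open>G\<close> of
  the remaining coordinates. For consecutive points the interlacing choice is unique, so the
  hypothesis is inherited by \<open>G\<close>; for arbitrary increasing points all summands are positive by
  induction.
\<close>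
lemma Fekete_consecutive_points:
  assumes "\<And>k x. k \<le> m \<Longrightarrow> x + k \<le> n \<Longrightarrow> 0 < det_fun k (\<lambda>p q. F (x + p) q)"
    and "k \<le> m" "strict_mono_on {..<k} X" "\<And>p. p < k \<Longrightarrow> X p < n"
  shows "0 < det_fun k (\<lambda>p q. F (X p) q)"
  using assms
proof (induction m arbitrary: F n k X)
  case 0
  thus ?case by simp
next
  case (Suc m)
  show ?case
  proof (cases k)
    case (Suc k')
    have F0: "0 < F x 0" if "x < n" for x
      using Suc.prems(1)[of 1 x] that det_fun_lower_triangular[of 1 "\<lambda>p q. F (x + p) q"] by simp
    define F' where "F' x q = F x (Suc q) / F x 0" for x q
    define G where "G y q = F' (Suc y) q - F' y q" for y q
    have key: "det_fun (Suc j) (\<lambda>p q. F (X p) q) = (\<Prod>p<Suc j. F (X p) 0) *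
        (\<Sum>f\<in>PiE {..<j} (\<lambda>p. {X p..<X (Suc p)}). det_fun j (\<lambda>p q. G (f p) q))"
      if X: "strict_mono_on {..<Suc j} X" "\<And>p. p < Suc j \<Longrightarrow> X p < n" for X :: "nat \<Rightarrow> nat" and j
    proof -
      have "det_fun (Suc j) (\<lambda>p q. F (X p) q) =
          det_fun (Suc j) (\<lambda>p q. F (X p) 0 * 1 * (case q of 0 \<Rightarrow> 1 | Suc q' \<Rightarrow> F' (X p) q'))"
      proof (rule det_fun_cong)
        fix p q assume "p < Suc j"
        hence "0 < F (X p) 0" by (intro F0 X(2))
        thus "F (X p) q = F (X p) 0 * 1 * (case q of 0 \<Rightarrow> 1 | Suc q' \<Rightarrow> F' (X p) q')"
          by (auto simp: F'_def split: nat.splits)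
      qed
      also have "\<dots> = (\<Prod>p<Suc j. F (X p) 0) * det_fun (Suc j) (\<lambda>p q. (case q of 0 \<Rightarrow> 1 | Suc q' \<Rightarrow> F' (X p) q'))"
        by (subst det_fun_scale) simp
      also have "det_fun (Suc j) (\<lambda>p q. (case q of 0 \<Rightarrow> 1 | Suc q' \<Rightarrow> F' (X p) q')) =
          (\<Sum>f\<in>PiE {..<j} (\<lambda>p. {X p..<X (Suc p)}). det_fun j (\<lambda>p q. F' (Suc (f p)) q - F' (f p) q))"
        by (rule det_fun_ones_column[OF X(1)]) auto
      finally show ?thesis by (simp add: G_def)
    qed
    have prod_pos: "0 < (\<Prod>p<j. F (X p) 0)" if "\<And>p. p < j \<Longrightarrow> X p < n" for j and X :: "nat \<Rightarrow> nat"
      using that F0 by (intro prod_pos) auto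
    have G: "0 < det_fun j (\<lambda>p q. G (y + p) q)" if "j \<le> m" "y + j \<le> n - 1" for j y
    proof (cases "j = 0")
      case False
      with that have yj: "y + Suc j \<le> n" by auto
      have "PiE {..<j} (\<lambda>p. {y + p..<y + Suc p}) = PiE {..<j} (\<lambda>p. {restrict (\<lambda>p. y + p) {..<j} p})"
        by (intro PiE_cong) auto
      also have "\<dots> = {restrict (\<lambda>p. y + p) {..<j}}" by (rule PiE_singleton[OF restrict_extensional])
      finally have "det_fun (Suc j) (\<lambda>p q. F (y + p) q) = (\<Prod>p<Suc j. F (y + p) 0) *
          det_fun j (\<lambda>p q. G (restrict (\<lambda>p. y + p) {..<j} p) q)"
        using key[of j "\<lambda>p. y + p"] yj by (simp add: strict_mono_on_def)
      also have "det_fun j (\<lambda>p q. G (restrict (\<lambda>p. y + p) {..<j} p) q) = det_fun j (\<lambda>p q. G (y + p) q)"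
        by (rule det_fun_cong) simp
      finally have "det_fun (Suc j) (\<lambda>p q. F (y + p) q) = (\<Prod>p<Suc j. F (y + p) 0) * det_fun j (\<lambda>p q. G (y + p) q)" .
      moreover have "0 < det_fun (Suc j) (\<lambda>p q. F (y + p) q)" using that yj by (intro Suc.prems(1)) auto
      moreover have "0 < (\<Prod>p<Suc j. F (y + p) 0)" using yj by (intro prod_pos) auto
      ultimately show ?thesis by (metis zero_less_mult_pos)
    qed simp
    have X: "strict_mono_on {..<Suc k'} X" "\<And>p. p < Suc k' \<Longrightarrow> X p < n"
      using Suc.prems Suc by auto
    have less: "X p < X (Suc p)" if "p < k'" for p using that by (intro strict_mono_onD[OF X(1)]) auto
    have ss: "0 < (\<Sum>f\<in>PiE {..<k'} (\<lambda>p. {X p..<X (Suc p)}). det_fun k' (\<lambda>p q. G (f p) q))"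
    proof (rule sum_pos)
      show "finite (PiE {..<k'} (\<lambda>p. {X p..<X (Suc p)}))" by (intro finite_PiE) auto
      show "PiE {..<k'} (\<lambda>p. {X p..<X (Suc p)}) \<noteq> {}" using less by (auto simp: PiE_eq_empty_iff)
    next
      fix f assume f: "f \<in> PiE {..<k'} (\<lambda>p. {X p..<X (Suc p)})"
      show "0 < det_fun k' (\<lambda>p q. G (f p) q)"
      proof (rule Suc.IH[of "n - 1" G k' f])
        fix p assume p: "p < k'"
        have "f p < X (Suc p)" using PiE_mem[OF f, of p] p by auto
        also have "X (Suc p) \<le> n - 1" using X(2)[of "Suc p"] p by simp
        finally show "f p < n - 1" .
      qed (use G Suc.prems(2) Suc interlacing_strict_mono[OF f] in auto)
    qed
    have pp: "0 < (\<Prod>p<Suc k'. F (X p) 0)" by (rule prod_pos) (rule X(2))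
    have "0 < det_fun (Suc k') (\<lambda>p q. F (X p) q)" by (subst key[OF X]) (assumption | rule mult_pos_pos[OF pp ss])+
    thus ?thesis by (simp only: Suc)
  qed simp
qed

text \<open>
  A minor of the two-sided Toeplitz matrix with consecutive rows and columns is determined by its
  order and its diagonal entry \<open>a k\<close>. Restricting \<open>k\<close> to an interval makes it possible to enlarge
  the support of \<open>a\<close> step by step.
\<close>
definition consec_pos :: "nat \<Rightarrow> int \<Rightarrow> int \<Rightarrow> (int \<Rightarrow> real) \<Rightarrow> bool" where
  "consec_pos r A B a \<longleftrightarrow>
     (\<forall>m\<le>r. \<forall>k\<in>{A..B}. 0 < det_fun m (\<lambda>p q. a (k + int q - int p)))"

text \<open>
  The previous lemma is applied twice: first the columns become arbitrary while the rows stay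
  consecutive, then the rows become arbitrary.
\<close>
lemma Fekete_Toeplitz:
  assumes "consec_pos r (- int n) (int n) a" "k \<le> r"
    and I: "strict_mono_on {..<k} I" "\<And>p. p < k \<Longrightarrow> I p < n"
    and J: "strict_mono_on {..<k} J" "\<And>p. p < k \<Longrightarrow> J p < n"
  shows "0 < det_fun k (\<lambda>p q. a (int (J q) - int (I p)))"
proof -
  have rows: "0 < det_fun j (\<lambda>p q. a (int (J q) - int (i + p)))"
    if "j \<le> k" "i + j \<le> n" for i j
  proof (cases "j = 0")
    case False
    have "0 < det_fun j (\<lambda>p q. a (int (J p) - int (i + q)))"
    proof (rule Fekete_consecutive_points[where m = j and n = n and F = "\<lambda>x q. a (int x - int (i + q))"])
      fix l x assume l: "l \<le> j" "x + l \<le> n"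
      have "0 < det_fun l (\<lambda>p q. a ((int x - int i) + int q - int p))"
        using assms(1,2) that l False unfolding consec_pos_def by auto
      also have "\<dots> = det_fun l (\<lambda>p q. a ((int x - int i) + int p - int q))"
        by (rule det_fun_transpose)
      also have "\<dots> = det_fun l (\<lambda>p q. a (int (x + p) - int (i + q)))"
        by (rule det_fun_cong) (simp add: algebra_simps)
      finally show "0 < det_fun l (\<lambda>p q. a (int (x + p) - int (i + q)))" .
    qed (use J that in \<open>auto simp: strict_mono_on_def\<close>)
    thus ?thesis using det_fun_transpose[of j "\<lambda>p q. a (int (J q) - int (i + p))"] by simp
  qed simp
  show ?thesis
    by (rule Fekete_consecutive_points[where m = k and n = n and F = "\<lambda>x q. a (int (J q) - int x)"])
       (use rows I in auto)
qed

lemma tendsto_det_fun: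
  assumes "\<And>p q. p < k \<Longrightarrow> q < k \<Longrightarrow> ((\<lambda>t. M t p q) \<longlongrightarrow> L p q) F"
  shows "((\<lambda>t. det_fun k (M t)) \<longlongrightarrow> det_fun k L) F"
  unfolding det_fun_Leibniz
  by (intro tendsto_sum tendsto_mult tendsto_const tendsto_prod assms) (auto intro: permutes_lessThan)

text \<open>
  Sequences that vanish on one side have vanishing consecutive minors, so the strict criterion
  does not apply to them directly. Here the support is enlarged by one tiny entry \<open>t\<close>: the old
  minors stay positive by continuity, and the new ones are determinants of triangular matrices
  with \<open>t\<close> on the diagonal.
\<close>
lemma consec_pos_extend_left_step:
  assumes a: "consec_pos r A B a" "\<And>k. k < A \<Longrightarrow> a k = 0" and "0 < \<delta>"
  shows "\<exists>t. 0 < t \<and> t < \<delta> \<and> consec_pos r (A - 1) B (a(A - 1 := t))"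
proof -
  have "\<forall>\<^sub>F t in at_right 0. 0 < det_fun m (\<lambda>p q. (a(A - 1 := t)) (k + int q - int p))"
    if "m \<le> r" "k \<in> {A..B}" for m k
  proof (rule order_tendstoD)
    show "((\<lambda>t. det_fun m (\<lambda>p q. (a(A - 1 := t)) (k + int q - int p)))
        \<longlongrightarrow> det_fun m (\<lambda>p q. a (k + int q - int p))) (at_right 0)"
    proof (rule tendsto_det_fun)
      fix p q
      show "((\<lambda>t. (a(A - 1 := t)) (k + int q - int p)) \<longlongrightarrow> a (k + int q - int p)) (at_right 0)"
        using a(2)[of "A - 1"] by (cases "k + int q - int p = A - 1") (auto intro: tendsto_ident_at)
    qed
    show "0 < det_fun m (\<lambda>p q. a (k + int q - int p))" using a(1) that by (auto simp: consec_pos_def)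
  qed
  hence "\<forall>\<^sub>F t in at_right 0. \<forall>m\<in>{..r}. \<forall>k\<in>{A..B}. 0 < det_fun m (\<lambda>p q. (a(A - 1 := t)) (k + int q - int p))"
    by (intro eventually_ball_finite ballI) auto
  moreover have "\<forall>\<^sub>F t in at_right 0. t \<in> {0<..<\<delta>}"
    using \<open>0 < \<delta>\<close> by (intro eventually_at_rightI[of 0 \<delta>]) auto
  ultimately have "\<forall>\<^sub>F t in at_right 0. t \<in> {0<..<\<delta>} \<and>
      (\<forall>m\<in>{..r}. \<forall>k\<in>{A..B}. 0 < det_fun m (\<lambda>p q. (a(A - 1 := t)) (k + int q - int p)))"
    by eventually_elim auto
  hence "\<exists>t. t \<in> {0<..<\<delta>} \<and>
      (\<forall>m\<in>{..r}. \<forall>k\<in>{A..B}. 0 < det_fun m (\<lambda>p q. (a(A - 1 := t)) (k + int q - int p)))"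
    by (rule eventually_happens'[OF trivial_limit_at_right_real])
  then obtain t where t: "0 < t" "t < \<delta>"
    "\<And>m k. m \<le> r \<Longrightarrow> k \<in> {A..B} \<Longrightarrow> 0 < det_fun m (\<lambda>p q. (a(A - 1 := t)) (k + int q - int p))"
    by (auto simp del: fun_upd_apply)
  have "0 < det_fun m (\<lambda>p q. (a(A - 1 := t)) (A - 1 + int q - int p))" for m
  proof -
    have "det_fun m (\<lambda>p q. (a(A - 1 := t)) (A - 1 + int q - int p)) = (\<Prod>p<m. t)"
      by (subst det_fun_upper_triangular) (auto simp: a(2))
    thus ?thesis using t(1) by simp
  qed
  hence "consec_pos r (A - 1) B (a(A - 1 := t))"
    unfolding consec_pos_def
  proof (intro allI impI ballI)
    fix m k assume *: "m \<le> r" "k \<in> {A - 1..B}"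
      and pos: "\<And>m. 0 < det_fun m (\<lambda>p q. (a(A - 1 := t)) (A - 1 + int q - int p))"
    show "0 < det_fun m (\<lambda>p q. (a(A - 1 := t)) (k + int q - int p))"
      using pos[of m] t(3)[of m k] * by (cases "k = A - 1") (auto simp del: fun_upd_apply)
  qed
  thus ?thesis using t by blast
qed

lemma consec_pos_extend_left:
  assumes a: "consec_pos r A B a" "\<And>k. k < A \<Longrightarrow> a k = 0" and "0 < \<delta>"
  shows "\<exists>a'. consec_pos r (A - int n) B a' \<and> (\<forall>k\<ge>A. a' k = a k) \<and>
           (\<forall>k<A - int n. a' k = 0) \<and> (\<forall>k. \<bar>a' k - a k\<bar> \<le> \<delta>)"
proof (induction n)
  case 0
  show ?case using assms by (intro exI[of _ a]) auto
next
  case (Suc n)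
  then obtain a' where a': "consec_pos r (A - int n) B a'" "\<forall>k\<ge>A. a' k = a k"
    "\<forall>k<A - int n. a' k = 0" "\<forall>k. \<bar>a' k - a k\<bar> \<le> \<delta>" by blast
  obtain t where t: "0 < t" "t < \<delta>" "consec_pos r (A - int n - 1) B (a'(A - int n - 1 := t))"
    using consec_pos_extend_left_step[OF a'(1) _ \<open>0 < \<delta>\<close>] a'(3) by blast
  show ?case
  proof (intro exI[of _ "a'(A - int n - 1 := t)"] conjI)
    show "consec_pos r (A - int (Suc n)) B (a'(A - int n - 1 := t))"
      using t(3) by (simp add: algebra_simps)
  qed (use t a' a(2) in auto)
qed

lemma consec_pos_reflect: "consec_pos r A B a \<Longrightarrow> consec_pos r (- B) (- A) (\<lambda>k. a (- k))"
proof -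
  have "det_fun m (\<lambda>p q. a (- (k + int q - int p))) = det_fun m (\<lambda>p q. a (- k + int q - int p))" for m k
  proof -
    have "det_fun m (\<lambda>p q. a (- k + int q - int p)) = det_fun m (\<lambda>p q. a (- k + int p - int q))"
      by (rule det_fun_transpose[symmetric])
    also have "\<dots> = det_fun m (\<lambda>p q. a (- (k + int q - int p)))" by (rule det_fun_cong) (simp add: algebra_simps)
    finally show ?thesis by simp
  qed
  thus "consec_pos r A B a \<Longrightarrow> consec_pos r (- B) (- A) (\<lambda>k. a (- k))"
    unfolding consec_pos_def by (metis atLeastAtMost_iff minus_le_iff le_minus_iff)
qed

text \<open>
  Reflection of the sequence transposes all the matrices, which reduces this to the extension on
  the left.
\<close>
lemma consec_pos_extend_right:
  assumes a: "consec_pos r A B a" "\<And>k. k > B \<Longrightarrow> a k = 0" and "0 < \<delta>"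
  shows "\<exists>a'. consec_pos r A (B + int n) a' \<and> (\<forall>k\<le>B. a' k = a k) \<and> (\<forall>k. \<bar>a' k - a k\<bar> \<le> \<delta>)"
proof -
  obtain a' where a': "consec_pos r (- B - int n) (- A) a'" "\<forall>k\<ge>-B. a' k = a (- k)"
    "\<forall>k. \<bar>a' k - a (- k)\<bar> \<le> \<delta>"
    using consec_pos_extend_left[OF consec_pos_reflect[OF a(1)] _ \<open>0 < \<delta>\<close>, of n] a(2) by auto
  show ?thesis
  proof (intro exI[of _ "\<lambda>k. a' (- k)"] conjI)
    show "consec_pos r A (B + int n) (\<lambda>k. a' (- k))" using consec_pos_reflect[OF a'(1)] by (simp add: algebra_simps)
    show "\<forall>k\<le>B. a' (- k) = a k" using a'(2) by auto
    show "\<forall>k. \<bar>a' (- k) - a k\<bar> \<le> \<delta>"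
    proof
      fix k show "\<bar>a' (- k) - a k\<bar> \<le> \<delta>" using spec[OF a'(3), of "-k"] by simp
    qed
  qed
qed

definition zero_extend :: "(nat \<Rightarrow> real) \<Rightarrow> int \<Rightarrow> real" where
  "zero_extend a k = (if k < 0 then 0 else a (nat k))"

lemma toeplitz_zero_extend: "toeplitz a i j = zero_extend a (int j - int i)"
  by (auto simp: toeplitz_def zero_extend_def nat_diff_distrib)

lemma toeplitz_minor_zero_extend:
  "toeplitz_minor a k I J = det_fun k (\<lambda>p q. zero_extend a (int (J q) - int (I p)))"
  by (simp add: toeplitz_minor_def toeplitz_zero_extend)

text \<open>
  Minors depend continuously on the entries, and a given minor involves only finitely many of
  them.
\<close>
lemma PF_seq_approx:
  assumes "\<And>n \<delta>. 0 < \<delta> \<Longrightarrow> \<exists>a'. consec_pos r (- int n) (int n) a' \<and> (\<forall>k. \<bar>a' k - zero_extend a k\<bar> \<le> \<delta>)"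
  shows "PF_seq r a"
  unfolding PF_seq_def
proof (intro allI impI)
  fix k :: nat and I J :: "nat \<Rightarrow> nat"
  assume *: "k \<le> r" "strict_mono_on {..<k} I" "strict_mono_on {..<k} J"
  define n where "n = Suc ((\<Sum>p<k. I p) + (\<Sum>p<k. J p))"
  have n: "I p < n" "J p < n" if "p < k" for p
    using that member_le_sum[of p "{..<k}" I] member_le_sum[of p "{..<k}" J] by (auto simp: n_def)
  have "\<exists>a'. \<forall>i. consec_pos r (- int n) (int n) (a' i) \<and>
      (\<forall>k. \<bar>a' i k - zero_extend a k\<bar> \<le> 1 / real (Suc i))"
    using assms[of "1 / real (Suc _)" n] by (intro choice) auto
  then obtain a' where a': "\<And>i. consec_pos r (- int n) (int n) (a' i)"
    "\<And>i k. \<bar>a' i k - zero_extend a k\<bar> \<le> 1 / real (Suc i)" by blast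
  have lim: "(\<lambda>i. a' i k) \<longlonglongrightarrow> zero_extend a k" for k
  proof -
    have "(\<lambda>i. a' i k - zero_extend a k) \<longlonglongrightarrow> 0"
      by (rule Lim_null_comparison[OF _ LIMSEQ_inverse_real_of_nat])
         (use a'(2) in \<open>auto simp: divide_inverse intro!: always_eventually\<close>)
    thus ?thesis by (rule LIM_zero_cancel)
  qed
  have "(\<lambda>i. det_fun k (\<lambda>p q. a' i (int (J q) - int (I p)))) \<longlonglongrightarrow> toeplitz_minor a k I J"
    unfolding toeplitz_minor_zero_extend by (intro tendsto_det_fun lim)
  moreover have "0 \<le> det_fun k (\<lambda>p q. a' i (int (J q) - int (I p)))" for i
    by (intro less_imp_le Fekete_Toeplitz[OF a'(1)] * n)
  ultimately show "0 \<le> toeplitz_minor a k I J" by (intro LIMSEQ_le_const) auto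
qed

theorem PF_seq_if_consecutive_minors_pos:
  assumes "\<And>k m. m \<le> r \<Longrightarrow> 0 < det_fun m (\<lambda>p q. zero_extend a (int k + int q - int p))"
  shows "PF_seq r a"
proof (rule PF_seq_approx)
  fix n and \<delta> :: real assume "0 < \<delta>"
  have "consec_pos r 0 (int n) (zero_extend a)"
    unfolding consec_pos_def
  proof (intro allI impI ballI)
    fix m k assume "m \<le> r" "k \<in> {0..int n}"
    thus "0 < det_fun m (\<lambda>p q. zero_extend a (k + int q - int p))" using assms[of m "nat k"] by simp
  qed
  moreover have "zero_extend a k = 0" if "k < 0" for k using that by (simp add: zero_extend_def)
  ultimately obtain a' where "consec_pos r (0 - int n) (int n) a'" "\<forall>k. \<bar>a' k - zero_extend a k\<bar> \<le> \<delta>"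
    using consec_pos_extend_left[OF _ _ \<open>0 < \<delta>\<close>, of r 0 "int n" "zero_extend a" n] by blast
  thus "\<exists>a'. consec_pos r (- int n) (int n) a' \<and> (\<forall>k. \<bar>a' k - zero_extend a k\<bar> \<le> \<delta>)"
    by auto
qed

theorem PF_seq_if_consecutive_minors_pos_finite:
  assumes "\<And>k m. m \<le> r \<Longrightarrow> k \<le> d \<Longrightarrow> 0 < det_fun m (\<lambda>p q. zero_extend a (int k + int q - int p))"
    and "\<And>k. k > d \<Longrightarrow> a k = 0"
  shows "PF_seq r a"
proof (rule PF_seq_approx)
  fix n and \<delta> :: real assume "0 < \<delta>"
  hence \<delta>: "0 < \<delta> / 2" by simp
  have "consec_pos r 0 (int d) (zero_extend a)"
    unfolding consec_pos_def
  proof (intro allI impI ballI)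
    fix m k assume "m \<le> r" "k \<in> {0..int d}"
    thus "0 < det_fun m (\<lambda>p q. zero_extend a (k + int q - int p))" using assms(1)[of m "nat k"] by (simp add: nat_le_iff)
  qed
  moreover have "zero_extend a k = 0" if "int d < k" for k
    using that assms(2) by (auto simp: zero_extend_def)
  ultimately obtain a1 where a1: "consec_pos r 0 (int d + int n) a1" "\<forall>k\<le>int d. a1 k = zero_extend a k"
    "\<forall>k. \<bar>a1 k - zero_extend a k\<bar> \<le> \<delta> / 2"
    using consec_pos_extend_right[OF _ _ \<delta>, of r 0 "int d" "zero_extend a" n] by blast
  have "a1 k = 0" if "k < 0" for k using a1(2) that by (auto simp: zero_extend_def)
  from consec_pos_extend_left[OF a1(1) this \<delta>, of n]
  obtain a2 where a2: "consec_pos r (- int n) (int d + int n) a2" "\<forall>k. \<bar>a2 k - a1 k\<bar> \<le> \<delta> / 2"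
    by auto
  have "consec_pos r (- int n) (int n) a2" using a2(1) by (auto simp: consec_pos_def)
  moreover have "\<bar>a2 k - zero_extend a k\<bar> \<le> \<delta>" for k
    using spec[OF a2(2), of k] spec[OF a1(3), of k] by linarith
  ultimately show "\<exists>a'. consec_pos r (- int n) (int n) a' \<and> (\<forall>k. \<bar>a' k - zero_extend a k\<bar> \<le> \<delta>)" by blast
qed

section \<open>Operations on sequences without negative minors\<close>

lemma PF_seq_convolution:
  assumes "PF_seq r a" "PF_seq r b"
  shows "PF_seq r (\<lambda>k. \<Sum>i\<le>k. a i * b (k - i))"
  unfolding PF_seq_def
proof (intro allI impI)
  fix k :: nat and I J :: "nat \<Rightarrow> nat"
  assume *: "k \<le> r" "strict_mono_on {..<k} I" "strict_mono_on {..<k} J"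
  define n where "n = Suc (\<Sum>p<k. J p)"
  have n: "J p < n" if "p < k" for p
    using that member_le_sum[of p "{..<k}" J] by (auto simp: n_def)
  have conv: "toeplitz (\<lambda>k. \<Sum>i\<le>k. a i * b (k - i)) i j = (\<Sum>s<n. toeplitz a i s * toeplitz b s j)"
    if "j < n" for i j
  proof (cases "i \<le> j")
    case True
    have "(\<Sum>s<n. toeplitz a i s * toeplitz b s j) = (\<Sum>s\<in>{i..j}. a (s - i) * b (j - s))"
      by (rule sum.mono_neutral_cong_right) (use that in \<open>auto simp: toeplitz_def\<close>)
    also have "\<dots> = (\<Sum>t\<le>j - i. a t * b (j - i - t))"
      by (rule sum.reindex_bij_witness[of _ "\<lambda>t. t + i" "\<lambda>s. s - i"]) (use True in auto)
    finally show ?thesis using True by (simp add: toeplitz_def)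
  next
    case False
    have "(\<Sum>s<n. toeplitz a i s * toeplitz b s j) = 0"
      by (rule sum.neutral) (use False in \<open>auto simp: toeplitz_def\<close>)
    thus ?thesis using False by (simp add: toeplitz_def)
  qed
  have "toeplitz_minor (\<lambda>k. \<Sum>i\<le>k. a i * b (k - i)) k I J =
      det_fun k (\<lambda>p q. \<Sum>s<n. toeplitz a (I p) s * toeplitz b s (J q))"
    unfolding toeplitz_minor_def by (rule det_fun_cong) (simp add: conv n)
  also have "\<dots> = (\<Sum>f\<in>incr_maps k n. toeplitz_minor a k I f * toeplitz_minor b k f J)"
    unfolding toeplitz_minor_def by (rule Cauchy_Binet)
  also have "\<dots> \<ge> 0"
    using assms * by (intro sum_nonneg mult_nonneg_nonneg) (auto simp: PF_seq_def incr_maps_def)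
  finally show "0 \<le> toeplitz_minor (\<lambda>k. \<Sum>i\<le>k. a i * b (k - i)) k I J" .
qed

lemma PF_seq_scale:
  assumes "PF_seq r a" "0 < c"
  shows "PF_seq r (\<lambda>k. c ^ k * a k)"
  unfolding PF_seq_def
proof (intro allI impI)
  fix k :: nat and I J :: "nat \<Rightarrow> nat"
  assume *: "k \<le> r" "strict_mono_on {..<k} I" "strict_mono_on {..<k} J"
  have "toeplitz_minor (\<lambda>k. c ^ k * a k) k I J =
      det_fun k (\<lambda>p q. inverse c ^ I p * c ^ J q * toeplitz a (I p) (J q))"
    unfolding toeplitz_minor_def
    by (rule det_fun_cong) (use \<open>0 < c\<close> in \<open>auto simp: toeplitz_def power_diff field_simps\<close>)
  also have "\<dots> = (\<Prod>p<k. inverse c ^ I p) * (\<Prod>q<k. c ^ J q) * toeplitz_minor a k I J"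
    unfolding toeplitz_minor_def by (rule det_fun_scale)
  also have "\<dots> \<ge> 0"
    using assms * by (intro mult_nonneg_nonneg prod_nonneg) (auto simp: PF_seq_def)
  finally show "0 \<le> toeplitz_minor (\<lambda>k. c ^ k * a k) k I J" .
qed

lemma PF_seq_limit:
  assumes "\<And>i. PF_seq r (a i)" "\<And>k. (\<lambda>i. a i k) \<longlonglongrightarrow> b k"
  shows "PF_seq r b"
  unfolding PF_seq_def
proof (intro allI impI)
  fix k :: nat and I J :: "nat \<Rightarrow> nat"
  assume *: "k \<le> r" "strict_mono_on {..<k} I" "strict_mono_on {..<k} J"
  have "(\<lambda>i. toeplitz_minor (a i) k I J) \<longlonglongrightarrow> toeplitz_minor b k I J"
    unfolding toeplitz_minor_def
    by (intro tendsto_det_fun) (use assms(2) in \<open>simp add: toeplitz_def\<close>)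
  moreover have "0 \<le> toeplitz_minor (a i) k I J" for i
    using assms(1) * by (auto simp: PF_seq_def)
  ultimately show "0 \<le> toeplitz_minor b k I J" by (intro LIMSEQ_le_const) auto
qed

lemma PF_seq_one: "PF_seq r (\<lambda>k. if k = 0 then 1 else 0)"
proof (rule PF_seq_if_consecutive_minors_pos_finite[where d = 0])
  fix k m :: nat assume "k \<le> 0"
  have "det_fun m (\<lambda>p q. zero_extend (\<lambda>k. if k = 0 then 1 else 0) (int k + int q - int p)) = 1"
    by (subst det_fun_upper_triangular) (use \<open>k \<le> 0\<close> in \<open>auto simp: zero_extend_def\<close>)
  thus "0 < det_fun m (\<lambda>p q. zero_extend (\<lambda>k. if k = 0 then 1 else 0) (int k + int q - int p))" by simp
qed auto

section \<open>Polynomials of large degree with a small linear coefficient\<close>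

text \<open>
  The products over \<open>s\<close> in row \<open>p\<close> and row \<open>p + 1\<close> differ in a single factor. Eliminating the
  first column with neighbouring rows therefore leaves the bracket
  \<open>sin (a + d) * sin b - sin a * sin (b + d) = sin d * sin (b - a)\<close>, which does not depend on the row,
  and what remains is a determinant of the same shape with \<open>m - 1\<close> and \<open>R - 1\<close>. Iterating, the
  determinant is a product of sines of angles in \<open>(0, pi)\<close>. The bound on \<open>X q + R - q\<close> instead
  of \<open>X q + R\<close> is what survives this induction and is just enough for consecutive points at the
  right end of the support.
\<close>
lemma sine_product_det_pos:
  fixes \<theta> :: real and h :: int and X :: "nat \<Rightarrow> int" and R m :: nat
  defines "S \<equiv> \<lambda>x::int. sin (\<theta> * of_int x)"
  assumes \<theta>: "0 < \<theta>" "\<theta> * of_int h = pi" and "m \<le> R"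
    and X: "\<And>q. q < m \<Longrightarrow> 0 \<le> X q" "\<And>q. q < m \<Longrightarrow> X q + int R - int q \<le> h"
      "\<And>p q. p < q \<Longrightarrow> q < m \<Longrightarrow> X p < X q"
  shows "0 < det_fun m (\<lambda>p q. (\<Prod>s<p. S (X q - int s)) * (\<Prod>s\<in>{Suc p..<m}. S (X q + int R - int s)))"
  using \<open>m \<le> R\<close> X
proof (induction m arbitrary: R X)
  case (Suc m)
  have S_pos: "0 < S x" if "0 < x" "x < h" for x
    unfolding S_def
  proof (rule sin_gt_zero)
    show "0 < \<theta> * of_int x" using that \<theta> by simp
    have "\<theta> * of_int x < \<theta> * of_int h" using that \<theta> by (intro mult_strict_left_mono) auto
    thus "\<theta> * of_int x < pi" using \<theta> by simp
  qed
  define M where "M p q = (\<Prod>s<p. S (X q - int s)) * (\<Prod>s\<in>{Suc p..<Suc m}. S (X q + int R - int s))" for p q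
  define u where "u p = S (X 0 + int R - int (Suc p))" for p
  define v where "v p = S (X 0 - int p)" for p
  have split: "{Suc p..<Suc m} = insert (Suc p) {Suc (Suc p)..<Suc m}" if "p < m" for p using that by auto
  have u_pos: "0 < u p" if "p < m" for p
    using that Suc.prems(1) Suc.prems(2)[of 0] Suc.prems(3)[of 0] unfolding u_def by (intro S_pos) auto
  have "(\<Prod>p<m. u p) * det_fun (Suc m) M = M 0 0 * det_fun m (\<lambda>p q. u p * M (Suc p) (Suc q) - v p * M p (Suc q))"
    by (rule det_fun_eliminate) (simp add: M_def u_def v_def split)
  also have "det_fun m (\<lambda>p q. u p * M (Suc p) (Suc q) - v p * M p (Suc q)) =
      det_fun m (\<lambda>p q. 1 * (S (int R - 1) * S (X (Suc q) - X 0)) *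
        ((\<Prod>s<p. S (X (Suc q) - int s)) * (\<Prod>s\<in>{Suc p..<m}. S (X (Suc q) + int (R - 1) - int s))))"
  proof (rule det_fun_cong)
    fix p q assume pq: "p < m" "q < m"
    define x where "x = X (Suc q)"
    have trig: "u p * S (x - int p) - v p * S (x + int R - int (Suc p)) = S (int R - 1) * S (x - X 0)"
    proof -
      have "sin (a + d) * sin b - sin a * sin (b + d) = sin d * sin (b - a)" for a b d :: real
      proof -
        have "sin (a + d) * sin b - sin a * sin (b + d) =
            cos a * sin d * sin b - sin a * (cos b * sin d)"
          by (simp add: sin_add algebra_simps)
        thus ?thesis by (simp add: sin_diff algebra_simps)
      qed
      from this[of "\<theta> * of_int (X 0 - int p)" "\<theta> * of_int (int R - 1)" "\<theta> * of_int (x - int p)"]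
      show ?thesis by (simp add: u_def v_def S_def algebra_simps)
    qed
    have shift: "(\<Prod>s\<in>{Suc (Suc p)..<Suc m}. S (x + int R - int s)) =
        (\<Prod>s\<in>{Suc p..<m}. S (x + int (R - 1) - int s))"
      using pq Suc.prems(1)
      by (subst prod.atLeast_Suc_lessThan_Suc_shift) (auto simp: algebra_simps of_nat_diff intro!: prod.cong)
    have "u p * M (Suc p) (Suc q) - v p * M p (Suc q) =
        (\<Prod>s<p. S (x - int s)) * (\<Prod>s\<in>{Suc (Suc p)..<Suc m}. S (x + int R - int s)) *
        (u p * S (x - int p) - v p * S (x + int R - int (Suc p)))"
      using pq by (simp add: M_def split x_def algebra_simps)
    thus "u p * M (Suc p) (Suc q) - v p * M p (Suc q) =
        1 * (S (int R - 1) * S (X (Suc q) - X 0)) *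
        ((\<Prod>s<p. S (X (Suc q) - int s)) * (\<Prod>s\<in>{Suc p..<m}. S (X (Suc q) + int (R - 1) - int s)))"
      unfolding trig shift by (simp add: x_def)
  qed
  also have "\<dots> = (\<Prod>q<m. S (int R - 1) * S (X (Suc q) - X 0)) *
      det_fun m (\<lambda>p q. (\<Prod>s<p. S (X (Suc q) - int s)) * (\<Prod>s\<in>{Suc p..<m}. S (X (Suc q) + int (R - 1) - int s)))"
    by (subst det_fun_scale) simp
  also have "M 0 0 * \<dots> > 0"
  proof (intro mult_pos_pos prod_pos)
    show "0 < M 0 0"
      unfolding M_def
    proof (intro mult_pos_pos prod_pos ballI)
      fix s assume "s \<in> {Suc 0..<Suc m}"
      thus "0 < S (X 0 + int R - int s)"
        using Suc.prems(1) Suc.prems(2)[of 0] Suc.prems(3)[of 0] by (intro S_pos) auto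
    qed simp
  next
    fix q assume q: "q \<in> {..<m}"
    show "0 < S (int R - 1)"
      using q Suc.prems(1) Suc.prems(2)[of 0] Suc.prems(3)[of 0] by (intro S_pos) auto
    show "0 < S (X (Suc q) - X 0)"
      using q Suc.prems(1) Suc.prems(2)[of 0] Suc.prems(3)[of "Suc q"] Suc.prems(4)[of 0 "Suc q"]
      by (intro S_pos) auto
  next
    show "0 < det_fun m (\<lambda>p q. (\<Prod>s<p. S (X (Suc q) - int s)) * (\<Prod>s\<in>{Suc p..<m}. S (X (Suc q) + int (R - 1) - int s)))"
    proof (rule Suc.IH)
      fix q assume "q < m"
      thus "X (Suc q) + int (R - 1) - int q \<le> h" using Suc.prems(1) Suc.prems(3)[of "Suc q"] by auto
    qed (use Suc.prems in auto)
  qed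
  finally have "0 < (\<Prod>p<m. u p) * det_fun (Suc m) M" .
  moreover have "0 < (\<Prod>p<m. u p)" using u_pos by (intro prod_pos) auto
  ultimately have "0 < det_fun (Suc m) M" by (metis zero_less_mult_pos)
  thus ?case unfolding M_def .
qed simp

lemma sin_multiple_le:
  assumes "0 \<le> t" "real n * t \<le> pi"
  shows "sin (real n * t) \<le> real n * sin t"
  using assms(2)
proof (induction n)
  case (Suc n)
  have nt: "real n * t \<le> pi" "t \<le> pi" using Suc.prems assms(1) by (auto simp: algebra_simps)
      (metis add_increasing2 assms(1) mult_nonneg_nonneg of_nat_0_le_iff order_trans add.commute le_add_same_cancel2)
  have "sin (real (Suc n) * t) = sin (real n * t) * cos t + cos (real n * t) * sin t"
    by (simp add: algebra_simps sin_add)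
  also have "\<dots> \<le> sin (real n * t) * 1 + 1 * sin t"
    using nt assms(1) by (intro add_mono mult_left_mono mult_right_mono sin_ge_zero) auto
  also have "\<dots> \<le> real (Suc n) * sin t" using Suc.IH nt by (simp add: algebra_simps)
  finally show ?case .
qed simp

lemma sin_shift_le:
  assumes "0 \<le> t" "t \<le> x" "x + real n * t \<le> pi"
  shows "sin (x + real n * t) \<le> (real n + 1) * sin x"
proof -
  have x: "0 \<le> x" "x \<le> pi" "t \<le> pi" and nt: "0 \<le> real n * t" "real n * t \<le> pi"
    using assms mult_nonneg_nonneg[of "real n" t] by linarith+
  have sx: "0 \<le> sin x" using x by (intro sin_ge_zero)
  have "cos x * sin (real n * t) \<le> real n * sin x"
  proof (cases "0 \<le> cos x")
    case True
    have "cos x * sin (real n * t) \<le> cos x * (real n * sin t)"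
      using True nt assms(1) by (intro mult_left_mono sin_multiple_le)
    also have "cos x * sin t = sin x * cos t - sin (x - t)" by (simp add: sin_diff)
    moreover have "sin x * cos t \<le> sin x * 1" using sx by (intro mult_left_mono) auto
    moreover have "0 \<le> sin (x - t)" using assms x by (intro sin_ge_zero) auto
    ultimately have "cos x * sin t \<le> sin x" by linarith
    hence "real n * (cos x * sin t) \<le> real n * sin x" by (intro mult_left_mono) auto
    with \<open>cos x * sin (real n * t) \<le> cos x * (real n * sin t)\<close> show ?thesis by (simp add: mult_ac)
  next
    case False
    have "0 \<le> sin (real n * t)" using nt by (intro sin_ge_zero)
    hence "cos x * sin (real n * t) \<le> 0" using False by (intro mult_nonpos_nonneg) auto
    also have "0 \<le> real n * sin x" using sx by simp
    finally show ?thesis .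
  qed
  moreover have "sin x * cos (real n * t) \<le> sin x * 1" using sx by (intro mult_left_mono) auto
  ultimately show ?thesis by (simp add: sin_add algebra_simps)
qed

text \<open>
  The value \<open>b x\<close> is the trigonometric binomial coefficient at an arbitrary integer. It vanishes
  on both sides of \<open>0..d\<close> as far as a consecutive minor of order at most \<open>r\<close> can reach, so that
  these minors see the product formula in all their entries.
\<close>
theorem PF_polynomial_small_linear_term:
  assumes "1 \<le> r"
  obtains a where "PF_seq r a" "a 0 = 1" "a d = 1" "\<And>k. k > d \<Longrightarrow> a k = 0"
    "\<And>k. 0 \<le> a k" "\<And>k. a k \<le> real r ^ k"
proof -
  define h where "h = int d + int r"
  define \<theta> where "\<theta> = pi / of_int h"
  have h: "0 < h" using assms by (simp add: h_def)
  have \<theta>: "0 < \<theta>" "\<theta> * of_int h = pi" using h by (auto simp: \<theta>_def)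
  define S where "S x = sin (\<theta> * of_int x)" for x :: int
  have S_pos: "0 < S x" if "0 < x" "x < h" for x
    unfolding S_def
  proof (rule sin_gt_zero)
    show "0 < \<theta> * of_int x" using that \<theta> by simp
    have "\<theta> * of_int x < \<theta> * of_int h" using that \<theta> by (intro mult_strict_left_mono) auto
    thus "\<theta> * of_int x < pi" using \<theta> by simp
  qed
  have S_refl: "S (h - x) = S x" for x
  proof -
    have "\<theta> * of_int (h - x) = pi - \<theta> * of_int x" using \<theta> by (simp add: algebra_simps)
    thus ?thesis by (simp add: S_def)
  qed
  have S0: "S 0 = 0" "S h = 0" using \<theta> by (auto simp: S_def)
  define C where "C = (\<Prod>i\<in>{1..<r}. S (int i))"
  have C: "0 < C" unfolding C_def by (intro prod_pos) (auto intro!: S_pos simp: h_def)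
  define b where "b x = (\<Prod>i\<in>{1..<r}. S (x + int i)) / C" for x
  define a where "a k = (if k \<le> d then b (int k) else 0)" for k
  have b_zero: "b x = 0" if "- int r < x \<and> x < 0 \<or> int d < x \<and> x < h" for x
  proof -
    have "\<exists>i\<in>{1..<r}. S (x + int i) = 0"
    proof (cases "x < 0")
      case True
      thus ?thesis using that S0(1) by (intro bexI[of _ "nat (- x)"]) (auto simp: h_def)
    next
      case False
      thus ?thesis using that S0(2) by (intro bexI[of _ "nat (h - x)"]) (auto simp: h_def)
    qed
    thus ?thesis by (simp add: b_def)
  qed
  have ext: "zero_extend a x = b x" if "- int r < x" "x < h" for x
    using that b_zero[of x] by (auto simp: zero_extend_def a_def nat_le_iff)
  have b_pos: "0 < b (int k)" if "k \<le> d" for k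
    unfolding b_def using that C by (intro divide_pos_pos prod_pos) (auto intro!: S_pos simp: h_def)
  show ?thesis
  proof
    show "PF_seq r a"
    proof (rule PF_seq_if_consecutive_minors_pos_finite[where d = d])
      fix k m assume mk: "m \<le> r" "k \<le> d"
      define X where "X q = int k + int q" for q
      define c where "c q = (\<Prod>t\<in>{1..int r - int m}. S (X q + t)) / C" for q
      have c_pos: "0 < c q" if "q < m" for q
        unfolding c_def using that C mk
        by (intro divide_pos_pos prod_pos) (auto intro!: S_pos simp: h_def X_def)
      \<comment> \<open>The factors common to a column split off; the others depend on the row as in the determinant of sines.\<close>
      have factor: "b (X q - int p) = c q * ((\<Prod>s<p. S (X q - int s)) *
          (\<Prod>s\<in>{Suc p..<m}. S (X q + int r - int s)))" if "p < m" for p q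
      proof -
        have "(\<Prod>i\<in>{1..<r}. S (X q - int p + int i)) = (\<Prod>t\<in>{1 - int p..int r - 1 - int p}. S (X q + t))"
          by (rule prod.reindex_bij_witness[of _ "\<lambda>t. nat (t + int p)" "\<lambda>i. int i - int p"])
             (auto simp: algebra_simps)
        also have "{1 - int p..int r - 1 - int p} =
            ({1 - int p..0} \<union> {1..int r - int m}) \<union> {int r - int m + 1..int r - 1 - int p}"
          using that mk by auto
        also have "(\<Prod>t\<in>\<dots>. S (X q + t)) = (\<Prod>t\<in>{1 - int p..0}. S (X q + t)) *
            (\<Prod>t\<in>{1..int r - int m}. S (X q + t)) * (\<Prod>t\<in>{int r - int m + 1..int r - 1 - int p}. S (X q + t))"
          using that mk by (subst prod.union_disjoint; (subst prod.union_disjoint)?) auto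
        also have "(\<Prod>t\<in>{1 - int p..0}. S (X q + t)) = (\<Prod>s<p. S (X q - int s))"
          by (rule prod.reindex_bij_witness[of _ "\<lambda>s. - int s" "\<lambda>t. nat (- t)"]) auto
        also have "(\<Prod>t\<in>{int r - int m + 1..int r - 1 - int p}. S (X q + t)) =
            (\<Prod>s\<in>{Suc p..<m}. S (X q + int r - int s))"
          by (rule prod.reindex_bij_witness[of _ "\<lambda>s. int r - int s" "\<lambda>t. nat (int r - t)"])
             (use mk in \<open>auto simp: algebra_simps\<close>)
        finally show ?thesis by (simp add: b_def c_def)
      qed
      have "det_fun m (\<lambda>p q. zero_extend a (int k + int q - int p)) =
          det_fun m (\<lambda>p q. 1 * c q * ((\<Prod>s<p. S (X q - int s)) * (\<Prod>s\<in>{Suc p..<m}. S (X q + int r - int s))))"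
      proof (rule det_fun_cong)
        fix p q assume pq: "p < m" "q < m"
        hence "zero_extend a (int k + int q - int p) = b (X q - int p)"
          using mk by (subst ext) (auto simp: X_def h_def)
        thus "zero_extend a (int k + int q - int p) =
          1 * c q * ((\<Prod>s<p. S (X q - int s)) * (\<Prod>s\<in>{Suc p..<m}. S (X q + int r - int s)))"
          using factor[OF pq(1)] by simp
      qed
      also have "\<dots> = (\<Prod>q<m. c q) *
          det_fun m (\<lambda>p q. (\<Prod>s<p. S (X q - int s)) * (\<Prod>s\<in>{Suc p..<m}. S (X q + int r - int s)))"
        by (subst det_fun_scale) simp
      also have "\<dots> > 0"
      proof (intro mult_pos_pos prod_pos)
        show "0 < det_fun m (\<lambda>p q. (\<Prod>s<p. S (X q - int s)) * (\<Prod>s\<in>{Suc p..<m}. S (X q + int r - int s)))"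
          unfolding S_def
          by (rule sine_product_det_pos[OF \<theta> mk(1)]) (use mk in \<open>auto simp: X_def h_def\<close>)
      qed (use c_pos in auto)
      finally show "0 < det_fun m (\<lambda>p q. zero_extend a (int k + int q - int p))" .
    qed (auto simp: a_def)
    show "a 0 = 1" using C by (simp add: a_def b_def C_def[symmetric] del: One_nat_def)
    have "(\<Prod>i\<in>{1..<r}. S (int d + int i)) = (\<Prod>i\<in>{1..<r}. S (int r - int i))"
    proof (rule prod.cong[OF refl])
      fix i show "S (int d + int i) = S (int r - int i)"
        using S_refl[of "int r - int i"] by (simp add: h_def algebra_simps)
    qed
    also have "\<dots> = C"
      unfolding C_def
      by (rule prod.reindex_bij_witness[of _ "\<lambda>i. r - i" "\<lambda>i. r - i"]) (auto simp: of_nat_diff)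
    finally show "a d = 1" using C by (simp add: a_def b_def)
    show "a k = 0" if "k > d" for k using that by (simp add: a_def)
    show nonneg: "0 \<le> a k" for k using b_pos[of k] by (auto simp: a_def)
    show "a k \<le> real r ^ k" for k
    proof (induction k)
      case 0
      show ?case using \<open>a 0 = 1\<close> by simp
    next
      case (Suc k)
      show ?case
      proof (cases "Suc k \<le> d")
        case True
        define P where "P = (\<Prod>i\<in>{Suc 1..<r}. S (int k + int i))"
        have "(\<Prod>i\<in>{1..<r}. S (int (Suc k) + int i)) = (\<Prod>i\<in>{Suc 1..<Suc r}. S (int k + int i))"
          by (subst prod.atLeast_Suc_lessThan_Suc_shift) (simp add: algebra_simps)
        also have "(\<Prod>i\<in>{Suc 1..<Suc r}. S (int k + int i)) * S (int k + 1) =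
            (\<Prod>i\<in>{1..<Suc r}. S (int k + int i))"
          using assms by (subst (2) prod.atLeast_Suc_lessThan) auto
        also have "\<dots> = (\<Prod>i\<in>{1..<r}. S (int k + int i)) * S (int k + int r)"
          using assms by simp
        finally have "b (int (Suc k)) * S (int k + 1) = b (int k) * S (int k + int r)"
          using C by (simp add: b_def field_simps)
        also have "S (int k + int r) \<le> real r * S (int k + 1)"
        proof -
          have "\<theta> * of_int (int k + int r) = \<theta> * of_int (int k + 1) + real (r - 1) * \<theta>"
            using assms by (simp add: of_nat_diff algebra_simps)
          moreover have "\<theta> * of_int (int k + int r) \<le> \<theta> * of_int h"
            using \<theta> True by (intro mult_left_mono) (auto simp: h_def)
          ultimately have "sin (\<theta> * of_int (int k + int r)) \<le> (real (r - 1) + 1) * sin (\<theta> * of_int (int k + 1))"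
            using sin_shift_le[of \<theta> "\<theta> * of_int (int k + 1)" "r - 1"] \<theta> by simp
          thus ?thesis using assms by (simp add: S_def of_nat_diff)
        qed
        finally have "b (int (Suc k)) * S (int k + 1) \<le> b (int k) * real r * S (int k + 1)"
          using b_pos[of k] True by (simp add: mult_left_mono mult_ac)
        moreover have "0 < S (int k + 1)" using True assms by (intro S_pos) (auto simp: h_def)
        ultimately have "b (int (Suc k)) \<le> b (int k) * real r" by simp
        hence "a (Suc k) \<le> a k * real r" using True by (simp add: a_def)
        also have "\<dots> \<le> real r ^ k * real r" by (intro mult_right_mono Suc) auto
        finally show ?thesis by (simp add: mult_ac)
      qed (simp add: a_def)
    qed
  qed
qed

section \<open>From an entire function to a function with a single singularity\<close>

lemma det_fun_reverse: "det_fun m (\<lambda>p q. M (m - Suc p) (m - Suc q)) = det_fun m M"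
proof -
  define s where "s p = (if p < m then m - Suc p else p)" for p
  have s: "s permutes {..<m}"
  proof (rule bij_imp_permutes)
    show "bij_betw s {..<m} {..<m}"
      by (rule bij_betw_byWitness[of _ s]) (auto simp: s_def)
  qed (simp add: s_def)
  have "det_fun m (\<lambda>p q. M (m - Suc p) (m - Suc q)) = det_fun m (\<lambda>p q. M (s p) (s q))"
    by (rule det_fun_cong) (simp add: s_def)
  also have "\<dots> = signof s * det_fun m (\<lambda>p q. M p (s q))"
    by (rule det_fun_permute_rows[OF s, where M = "\<lambda>p q. M p (s q)"])
  also have "det_fun m (\<lambda>p q. M p (s q)) = det_fun m (\<lambda>p q. M q (s p))"
    by (rule det_fun_transpose[symmetric])
  also have "\<dots> = signof s * det_fun m (\<lambda>p q. M q p)"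
    by (rule det_fun_permute_rows[OF s, where M = "\<lambda>p q. M q p"])
  also have "det_fun m (\<lambda>p q. M q p) = det_fun m M"
    by (rule det_fun_transpose)
  finally show ?thesis by (simp add: sign_def)
qed

text \<open>
  If the first lower index is 0, the matrix has a column of ones and Pascal's rule turns the
  differences into binomial coefficients of smaller order; otherwise the absorption identity
  lowers all indices.
\<close>
lemma Pascal_minor_nonneg:
  fixes X S :: "nat \<Rightarrow> nat"
  assumes "strict_mono_on {..<m} X" "strict_mono_on {..<m} S"
  shows "0 \<le> det_fun m (\<lambda>p q. real (X p choose S q))"
  using assms
proof (induction m arbitrary: X S)
  case (Suc m)
  show ?case using Suc.prems
  proof (induction "S 0" arbitrary: X S)
    case 0
    have S: "0 < S (Suc q)" if "q < m" for q
      using strict_mono_onD[OF 0(3), of 0 "Suc q"] that by auto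
    have "det_fun (Suc m) (\<lambda>p q. real (X p choose S q)) =
        (\<Sum>f\<in>PiE {..<m} (\<lambda>p. {X p..<X (Suc p)}).
          det_fun m (\<lambda>p q. real (Suc (f p) choose S (Suc q)) - real (f p choose S (Suc q))))"
      by (rule det_fun_ones_column[OF 0(2)]) (simp_all add: 0(1)[symmetric])
    also have "\<dots> \<ge> 0"
    proof (rule sum_nonneg)
      fix f assume f: "f \<in> PiE {..<m} (\<lambda>p. {X p..<X (Suc p)})"
      have "det_fun m (\<lambda>p q. real (Suc (f p) choose S (Suc q)) - real (f p choose S (Suc q))) =
          det_fun m (\<lambda>p q. real (f p choose (S (Suc q) - 1)))"
      proof (rule det_fun_cong)
        fix p q assume "q < m"
        then obtain n where "S (Suc q) = Suc n" using S[of q] gr0_implies_Suc by blast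
        thus "real (Suc (f p) choose S (Suc q)) - real (f p choose S (Suc q)) =
            real (f p choose (S (Suc q) - 1))" by simp
      qed
      also have "\<dots> \<ge> 0"
      proof (rule Suc.IH[OF interlacing_strict_mono[OF f]])
        show "strict_mono_on {..<m} (\<lambda>q. S (Suc q) - 1)"
        proof (rule strict_mono_on_lessThanI)
          fix p assume "Suc p < m"
          hence "S (Suc p) < S (Suc (Suc p))" by (intro strict_mono_onD[OF 0(3)]) auto
          thus "S (Suc p) - 1 < S (Suc (Suc p)) - 1" using S[of p] \<open>Suc p < m\<close> by simp
        qed
      qed
      finally show "0 \<le> det_fun m (\<lambda>p q. real (Suc (f p) choose S (Suc q)) - real (f p choose S (Suc q)))" .
    qed
    finally show ?case .
  next
    case (Suc n)
    have S: "0 < S q" if "q < Suc m" for q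
      using strict_mono_onD[OF Suc.prems(2), of 0 q] that Suc.hyps(2) by (cases "q = 0") auto
    show ?case
    proof (cases "X 0 = 0")
      case True
      have "det_fun (Suc m) (\<lambda>p q. real (X p choose S q)) =
          det_fun (Suc m) (\<lambda>p q. (if p = 0 then 0 else 1) * 1 * real (X p choose S q))"
        by (rule det_fun_cong) (use True S in auto)
      also have "\<dots> = 0" by (subst det_fun_scale) (simp add: prod.lessThan_Suc_shift del: prod.lessThan_Suc)
      finally show ?thesis by simp
    next
      case False
      have X: "0 < X p" if "p < Suc m" for p
        using strict_mono_onD[OF Suc.prems(1), of 0 p] that False by (cases "p = 0") auto
      have "det_fun (Suc m) (\<lambda>p q. real (X p choose S q)) =
          det_fun (Suc m) (\<lambda>p q. real (X p) * inverse (real (S q)) * real ((X p - 1) choose (S q - 1)))"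
      proof (rule det_fun_cong)
        fix p q assume "p < Suc m" "q < Suc m"
        hence "real (S q) * real (X p choose S q) = real (X p) * real ((X p - 1) choose (S q - 1))"
          using times_binomial_minus1_eq[of "S q" "X p"] S by (metis of_nat_mult)
        thus "real (X p choose S q) = real (X p) * inverse (real (S q)) * real ((X p - 1) choose (S q - 1))"
          using S[OF \<open>q < Suc m\<close>] by (simp add: field_simps)
      qed
      also have "\<dots> = (\<Prod>p<Suc m. real (X p)) * (\<Prod>q<Suc m. inverse (real (S q))) *
          det_fun (Suc m) (\<lambda>p q. real ((X p - 1) choose (S q - 1)))" by (rule det_fun_scale)
      also have "\<dots> \<ge> 0"
      proof (intro mult_nonneg_nonneg prod_nonneg)
        show "0 \<le> det_fun (Suc m) (\<lambda>p q. real ((X p - 1) choose (S q - 1)))"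
        proof (rule Suc.hyps(1))
          show "n = S 0 - 1" using Suc.hyps(2) by simp
          show "strict_mono_on {..<Suc m} (\<lambda>p. X p - 1)"
          proof (rule strict_mono_on_lessThanI)
            fix p assume "Suc p < Suc m"
            thus "X p - 1 < X (Suc p) - 1"
              using strict_mono_onD[OF Suc.prems(1), of p "Suc p"] X[of p] by simp
          qed
          show "strict_mono_on {..<Suc m} (\<lambda>p. S p - 1)"
          proof (rule strict_mono_on_lessThanI)
            fix p assume "Suc p < Suc m"
            thus "S p - 1 < S (Suc p) - 1"
              using strict_mono_onD[OF Suc.prems(2), of p "Suc p"] S[of p] by simp
          qed
        qed
      qed auto
      finally show ?thesis .
    qed
  qed
qed simp

lemma Pascal_consecutive_minor: "det_fun m (\<lambda>p q. real ((k + p) choose q)) = 1"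
proof -
  define A where "A p s = real (p choose s)" for p s
  define B where "B s q = (if s \<le> q then real (k choose (q - s)) else 0)" for s q
  have "det_fun m (\<lambda>p q. real ((k + p) choose q)) = det_fun m (\<lambda>p q. \<Sum>s<m. A p s * B s q)"
  proof (rule det_fun_cong)
    fix p q assume "q < m"
    hence "(\<Sum>s<m. A p s * B s q) = (\<Sum>s\<le>q. real ((p choose s) * (k choose (q - s))))"
      by (intro sum.mono_neutral_cong_right) (auto simp: A_def B_def)
    also have "\<dots> = real ((p + k) choose q)" by (simp only: of_nat_sum[symmetric] vandermonde)
    finally show "real ((k + p) choose q) = (\<Sum>s<m. A p s * B s q)" by (simp add: add.commute)
  qed
  also have "\<dots> = det_fun m A * det_fun m B" by (rule det_fun_mult)
  also have "det_fun m A = 1" by (subst det_fun_lower_triangular) (auto simp: A_def)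
  also have "det_fun m B = 1" by (subst det_fun_upper_triangular) (auto simp: B_def)
  finally show ?thesis by simp
qed

text \<open>
  These are the Taylor coefficients at 0 of \<open>B (z / (1 - z)) / (1 - z) ^ (N + 1)\<close>, where \<open>B\<close> is
  the generating function of \<open>b\<close>.
\<close>
definition binomial_transform :: "nat \<Rightarrow> (nat \<Rightarrow> real) \<Rightarrow> nat \<Rightarrow> real" where
  "binomial_transform N b k = (\<Sum>m\<le>k. b m * real ((k + N) choose (m + N)))"

text \<open>
  The Vandermonde convolution separates \<open>i\<close> from \<open>j\<close>. The lower indices are shifted by \<open>N\<close> in
  \<open>binomial_transform\<close> so that the formula remains true for \<open>j < i \<le> N\<close>, where both sides vanish.
\<close>
lemma binomial_transform_factorization:
  assumes "i \<le> N" "j < n"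
  shows "zero_extend (binomial_transform N b) (int j - int i) =
    (\<Sum>t<n. (\<Sum>l<Suc N. real ((N - i) choose (N - l)) * toeplitz b l t) * real (j choose t))"
proof -
  have inner: "(\<Sum>t<n. toeplitz b l t * real (j choose t)) = (\<Sum>m<n. b m * real (j choose (m + l)))" for l
  proof -
    have "(\<Sum>t<n. toeplitz b l t * real (j choose t)) = (\<Sum>t\<in>{l..<n}. b (t - l) * real (j choose t))"
      by (rule sum.mono_neutral_cong_right) (auto simp: toeplitz_def)
    also have "\<dots> = (\<Sum>m\<in>{m. m + l < n}. b m * real (j choose (m + l)))"
      by (rule sum.reindex_bij_witness[of _ "\<lambda>m. m + l" "\<lambda>t. t - l"]) auto
    also have "\<dots> = (\<Sum>m<n. b m * real (j choose (m + l)))"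
      by (rule sum.mono_neutral_left) (use assms(2) in \<open>auto intro!: binomial_eq_0\<close>)
    finally show ?thesis .
  qed
  have vander: "(\<Sum>l<Suc N. real ((N - i) choose (N - l)) * real (j choose (m + l))) =
      real ((N - i + j) choose (N + m))" for m
  proof -
    have "real ((N - i + j) choose (N + m)) =
        (\<Sum>t\<le>N + m. real (j choose t) * real ((N - i) choose (N + m - t)))"
      by (simp only: add.commute[of "N - i" j] vandermonde[symmetric] of_nat_sum of_nat_mult)
    also have "\<dots> = (\<Sum>t\<in>{m..N + m}. real (j choose t) * real ((N - i) choose (N + m - t)))"
      by (rule sum.mono_neutral_right) (auto intro!: binomial_eq_0)
    also have "\<dots> = (\<Sum>l<Suc N. real ((N - i) choose (N - l)) * real (j choose (m + l)))"
      by (rule sum.reindex_bij_witness[of _ "\<lambda>l. m + l" "\<lambda>t. t - m"]) auto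
    finally show ?thesis by simp
  qed
  have "(\<Sum>t<n. (\<Sum>l<Suc N. real ((N - i) choose (N - l)) * toeplitz b l t) * real (j choose t)) =
      (\<Sum>l<Suc N. real ((N - i) choose (N - l)) * (\<Sum>t<n. toeplitz b l t * real (j choose t)))"
    by (simp only: sum_distrib_left sum_distrib_right mult.assoc) (rule sum.swap)
  also have "\<dots> = (\<Sum>m<n. b m * (\<Sum>l<Suc N. real ((N - i) choose (N - l)) * real (j choose (m + l))))"
    unfolding inner sum_distrib_left by (subst sum.swap) (simp only: mult_ac)
  also have "\<dots> = (\<Sum>m<n. b m * real ((N - i + j) choose (N + m)))"
    unfolding vander ..
  also have "\<dots> = zero_extend (binomial_transform N b) (int j - int i)"
  proof (cases "i \<le> j")
    case True
    have "(\<Sum>m<n. b m * real ((N - i + j) choose (N + m))) =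
        (\<Sum>m\<le>j - i. b m * real ((j - i + N) choose (m + N)))"
      using assms True
      by (intro sum.mono_neutral_cong_right) (auto intro!: binomial_eq_0 simp: add.commute)
    thus ?thesis using True
      by (simp add: zero_extend_def binomial_transform_def nat_diff_distrib)
  next
    case False
    have "(\<Sum>m<n. b m * real ((N - i + j) choose (N + m))) = 0"
      using assms False by (intro sum.neutral) (auto intro!: binomial_eq_0)
    thus ?thesis using False by (simp add: zero_extend_def)
  qed
  finally show ?thesis ..
qed

text \<open>
  All minors in the rows \<open>0..N\<close> are non-negative by two applications of the Cauchy--Binet formula.
  For strict positivity it suffices to find one positive summand: choosing the indices \<open>0..<m\<close>
  in both intermediate sums gives a unitriangular matrix, a triangular matrix with diagonal
  \<open>b 0\<close>, and a Pascal minor equal to 1.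
\<close>
theorem PF_seq_binomial_transform:
  assumes b: "PF_seq (Suc N) b" "0 < b 0"
  shows "PF_seq (Suc N) (binomial_transform N b)"
proof (rule PF_seq_if_consecutive_minors_pos)
  fix k m assume m: "m \<le> Suc N"
  define n where "n = k + m"
  define A where "A i l = real ((N - i) choose (N - l))" for i l
  define E where "E i t = (\<Sum>l<Suc N. A i l * toeplitz b l t)" for i t
  let ?id = "\<lambda>p. if p < m then p else undefined"
  have id: "?id \<in> incr_maps m n'" if "m \<le> n'" for n'
    using that by (auto simp: incr_maps_def strict_mono_on_def PiE_def extensional_def)
  have A_nonneg: "0 \<le> det_fun m (\<lambda>p q. A p (f q))" if f: "f \<in> incr_maps m (Suc N)" for f
  proof -
    have fN: "f q \<le> N" if "q < m" for q using f that by (auto simp: incr_maps_def PiE_iff less_Suc_eq_le)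
    have mono: "f p < f q" if "p < q" "q < m" for p q
      using f that by (auto simp: incr_maps_def strict_mono_on_def)
    \<comment> \<open>Reversing both rows and columns makes the indices increasing and leaves the determinant unchanged.\<close>
    have "0 \<le> det_fun m (\<lambda>p q. real ((N - (m - Suc p)) choose (N - f (m - Suc q))))"
    proof (rule Pascal_minor_nonneg; rule strict_mono_on_lessThanI)
      fix p assume p: "Suc p < m"
      show "N - (m - Suc p) < N - (m - Suc (Suc p))" using p m by simp
      have "f (m - Suc (Suc p)) < f (m - Suc p)" using p by (intro mono) auto
      moreover have "f (m - Suc p) \<le> N" using p by (intro fN) auto
      ultimately show "N - f (m - Suc p) < N - f (m - Suc (Suc p))" by simp
    qed
    also have "\<dots> = det_fun m (\<lambda>p q. A p (f q))"
      using det_fun_reverse[of m "\<lambda>p q. A p (f q)"] by (simp add: A_def)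
    finally show ?thesis .
  qed
  have E_expand: "det_fun m (\<lambda>p q. E p (g q)) =
      (\<Sum>f\<in>incr_maps m (Suc N). det_fun m (\<lambda>p q. A p (f q)) * toeplitz_minor b m f g)" for g
    unfolding E_def toeplitz_minor_def
    by (rule Cauchy_Binet[where B = "\<lambda>l q. toeplitz b l (g q)"])
  have b_nonneg: "0 \<le> toeplitz_minor b m f g"
    if "f \<in> incr_maps m n1" "g \<in> incr_maps m n2" for f g n1 n2
    using b(1) m that by (auto simp: PF_seq_def incr_maps_def)
  have E_nonneg: "0 \<le> det_fun m (\<lambda>p q. E p (g q))" if "g \<in> incr_maps m n" for g
    unfolding E_expand using that by (intro sum_nonneg mult_nonneg_nonneg A_nonneg b_nonneg)
  have "det_fun m (\<lambda>p q. A p (?id q)) = det_fun m (\<lambda>p q. A p q)" by (rule det_fun_cong) simp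
  also have "\<dots> = (\<Prod>p<m. A p p)"
    by (rule det_fun_upper_triangular) (use m in \<open>auto simp: A_def\<close>)
  also have "\<dots> = 1" by (simp add: A_def)
  finally have A1: "det_fun m (\<lambda>p q. A p (?id q)) = 1" .
  have "toeplitz_minor b m ?id ?id = det_fun m (\<lambda>p q. toeplitz b p q)"
    unfolding toeplitz_minor_def by (rule det_fun_cong) simp
  also have "\<dots> = (\<Prod>p<m. toeplitz b p p)" by (rule det_fun_upper_triangular) (simp add: toeplitz_def)
  also have "\<dots> > 0" using b(2) by (intro prod_pos) (simp add: toeplitz_def)
  finally have b1: "0 < toeplitz_minor b m ?id ?id" .
  have "0 < det_fun m (\<lambda>p q. A p (?id q)) * toeplitz_minor b m ?id ?id" using A1 b1 by simp
  also have "\<dots> \<le> det_fun m (\<lambda>p q. E p (?id q))"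
    unfolding E_expand
    by (rule member_le_sum[where f = "\<lambda>f. det_fun m (\<lambda>p q. A p (f q)) * toeplitz_minor b m f ?id"])
       (use id m in \<open>auto intro!: mult_nonneg_nonneg A_nonneg b_nonneg id simp: n_def\<close>)
  finally have E1: "0 < det_fun m (\<lambda>p q. E p (?id q))" .
  have C_nonneg: "0 \<le> det_fun m (\<lambda>p q. real ((k + q) choose f p))" if "f \<in> incr_maps m n" for f
  proof -
    have "0 \<le> det_fun m (\<lambda>p q. real ((k + p) choose f q))"
      by (rule Pascal_minor_nonneg) (use that in \<open>auto simp: incr_maps_def strict_mono_on_def\<close>)
    thus ?thesis using det_fun_transpose[of m "\<lambda>p q. real ((k + q) choose f p)"] by simp
  qed
  have "det_fun m (\<lambda>p q. real ((k + q) choose ?id p)) = det_fun m (\<lambda>p q. real ((k + q) choose p))"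
    by (rule det_fun_cong) simp
  also have "\<dots> = det_fun m (\<lambda>p q. real ((k + p) choose q))"
    by (rule det_fun_transpose)
  also have "\<dots> = 1" by (rule Pascal_consecutive_minor)
  finally have C1: "det_fun m (\<lambda>p q. real ((k + q) choose ?id p)) = 1" .
  have "0 < det_fun m (\<lambda>p q. E p (?id q)) * det_fun m (\<lambda>p q. real ((k + q) choose ?id p))"
    using E1 C1 by simp
  also have "\<dots> \<le> (\<Sum>f\<in>incr_maps m n. det_fun m (\<lambda>p q. E p (f q)) * det_fun m (\<lambda>p q. real ((k + q) choose f p)))"
    by (rule member_le_sum[where f = "\<lambda>f. det_fun m (\<lambda>p q. E p (f q)) * det_fun m (\<lambda>p q. real ((k + q) choose f p))"])
       (use id in \<open>auto intro!: mult_nonneg_nonneg E_nonneg C_nonneg simp: n_def\<close>)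
  also have "\<dots> = det_fun m (\<lambda>p q. \<Sum>t<n. E p t * real ((k + q) choose t))"
    by (rule Cauchy_Binet[symmetric])
  also have "\<dots> = det_fun m (\<lambda>p q. zero_extend (binomial_transform N b) (int k + int q - int p))"
  proof (rule det_fun_cong)
    fix p q assume "p < m" "q < m"
    hence "zero_extend (binomial_transform N b) (int (k + q) - int p) =
        (\<Sum>t<n. E p t * real ((k + q) choose t))"
      unfolding E_def A_def using m by (intro binomial_transform_factorization) (auto simp: n_def)
    thus "(\<Sum>t<n. E p t * real ((k + q) choose t)) =
        zero_extend (binomial_transform N b) (int k + int q - int p)" by simp
  qed
  finally show "0 < det_fun m (\<lambda>p q. zero_extend (binomial_transform N b) (int k + int q - int p))" .
qed

lemma negative_binomial_sums:
  fixes z :: complex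
  assumes "norm z < 1"
  shows "(\<lambda>k. of_nat ((k + N) choose (m + N)) * z ^ k) sums (z ^ m / (1 - z) ^ (m + N + 1))"
proof -
  define M where "M = m + N"
  have nz: "1 - z \<noteq> 0" using assms by auto
  have "(\<lambda>i. (- of_nat (Suc M) gchoose i) * (- z) ^ i) sums (1 + (- z)) powr (- of_nat (Suc M))"
    by (rule gen_binomial_complex) (use assms in simp)
  moreover have "(- of_nat (Suc M) gchoose i) * (- z) ^ i = of_nat ((i + M) choose M) * z ^ i" for i
  proof -
    have "(- of_nat (Suc M) gchoose i :: complex) = (- 1) ^ i * (of_nat (M + i) gchoose i)"
      by (subst gbinomial_minus) (simp add: algebra_simps)
    also have "(of_nat (M + i) gchoose i :: complex) = of_nat ((M + i) choose i)"
      by (rule binomial_gbinomial[symmetric])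
    also have "(M + i) choose i = (i + M) choose M"
      using binomial_symmetric[of i "M + i"] by (simp add: add.commute)
    finally have "(- of_nat (Suc M) gchoose i) * (- z) ^ i =
        of_nat ((i + M) choose M) * ((- 1) ^ i * (- z) ^ i)" by (simp only: mult_ac)
    also have "(- 1) ^ i * (- z) ^ i = z ^ i" by (subst power_mult_distrib[symmetric]) simp
    finally show ?thesis .
  qed
  moreover have "(1 + (- z)) powr (- of_nat (Suc M)) = 1 / (1 - z) ^ Suc M"
  proof -
    have "(1 - z) powr of_nat (Suc M) = (1 - z) ^ Suc M" by (intro powr_nat' disjI1 nz)
    thus ?thesis by (simp only: powr_minus divide_inverse mult_1_left diff_conv_add_uminus)
  qed
  ultimately have "(\<lambda>i. of_nat ((i + M) choose M) * z ^ i) sums (1 / (1 - z) ^ Suc M)" by simp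
  hence "(\<lambda>i. z ^ m * (of_nat ((i + M) choose M) * z ^ i)) sums (z ^ m * (1 / (1 - z) ^ Suc M))"
    by (rule sums_mult)
  hence "(\<lambda>i. of_nat ((i + m + N) choose (m + N)) * z ^ (i + m)) sums (z ^ m / (1 - z) ^ (m + N + 1))"
    by (simp add: M_def power_add mult_ac add_ac)
  moreover have "(\<Sum>k<m. of_nat ((k + N) choose (m + N)) * z ^ k) = 0"
    by (rule sum.neutral) auto
  ultimately show ?thesis
    using sums_iff_shift[of "\<lambda>k. of_nat ((k + N) choose (m + N)) * z ^ k" m] by simp
qed

text \<open>
  The double series converges absolutely, because the sum of the moduli is the same expression
  evaluated at \<open>norm z\<close>; hence the order of summation can be exchanged.
\<close>
theorem binomial_transform_sums:
  fixes b :: "nat \<Rightarrow> real" and z :: complex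
  assumes "\<And>m. 0 \<le> b m" "\<And>x. 0 \<le> x \<Longrightarrow> summable (\<lambda>m. b m * x ^ m)" "norm z < 1"
  shows "(\<lambda>k. of_real (binomial_transform N b k) * z ^ k) sums
           ((\<Sum>m. of_real (b m) * (z / (1 - z)) ^ m) / (1 - z) ^ Suc N)"
proof -
  define f where "f = (\<lambda>(m, k). of_real (b m) * (of_nat ((k + N) choose (m + N)) * z ^ k))"
  have inner: "((\<lambda>k. f (m, k)) has_sum (of_real (b m) * (z ^ m / (1 - z) ^ (m + N + 1)))) UNIV"
    and abs: "((\<lambda>k. norm (f (m, k))) has_sum (b m * (norm z ^ m / (1 - norm z) ^ (m + N + 1)))) UNIV" for m
  proof -
    have "(\<lambda>k. of_nat ((k + N) choose (m + N)) * of_real (norm z) ^ k) sums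
        (of_real (norm z) ^ m / (1 - complex_of_real (norm z)) ^ (m + N + 1))"
      by (rule negative_binomial_sums) (use assms in simp)
    hence "(\<lambda>k. complex_of_real (real ((k + N) choose (m + N)) * norm z ^ k)) sums
        complex_of_real (norm z ^ m / (1 - norm z) ^ (m + N + 1))" by simp
    hence "(\<lambda>k. real ((k + N) choose (m + N)) * norm z ^ k) sums
        (norm z ^ m / (1 - norm z) ^ (m + N + 1))" by (simp only: sums_of_real_iff)
    from sums_mult[OF this, of "b m"]
    have abs': "(\<lambda>k. norm (f (m, k))) sums (b m * (norm z ^ m / (1 - norm z) ^ (m + N + 1)))"
      using assms(1)[of m] by (simp add: f_def norm_mult norm_power)
    thus "((\<lambda>k. norm (f (m, k))) has_sum (b m * (norm z ^ m / (1 - norm z) ^ (m + N + 1)))) UNIV"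
      by (rule sums_nonneg_imp_has_sum) simp
    have "(\<lambda>k. f (m, k)) sums (of_real (b m) * (z ^ m / (1 - z) ^ (m + N + 1)))"
      unfolding f_def prod.case using negative_binomial_sums[OF assms(3)] by (rule sums_mult)
    thus "((\<lambda>k. f (m, k)) has_sum (of_real (b m) * (z ^ m / (1 - z) ^ (m + N + 1)))) UNIV"
      using abs' by (intro norm_summable_imp_has_sum) (auto simp: sums_iff)
  qed
  define x where "x = norm z / (1 - norm z)"
  have x: "0 \<le> x" using assms(3) by (simp add: x_def)
  have eq: "b m * (norm z ^ m / (1 - norm z) ^ (m + N + 1)) = b m * x ^ m / (1 - norm z) ^ Suc N" for m
    by (simp add: x_def power_divide power_add)
  have "summable (\<lambda>m. b m * x ^ m / (1 - norm z) ^ Suc N)"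
    by (intro summable_divide assms(2) x)
  hence "(\<lambda>m. b m * (norm z ^ m / (1 - norm z) ^ (m + N + 1))) summable_on UNIV"
    unfolding eq
    by (rule summable_nonneg_imp_summable_on) (use assms x in \<open>auto intro!: divide_nonneg_nonneg\<close>)
  moreover have "norm (b m * (norm z ^ m / (1 - norm z) ^ (m + N + 1))) =
      b m * (norm z ^ m / (1 - norm z) ^ (m + N + 1))" for m
    using assms(1)[of m] assms(3) by simp
  ultimately have "(\<lambda>m. norm (infsum (\<lambda>k. norm (f (m, k))) UNIV)) summable_on UNIV"
    by (simp only: infsumI[OF abs])
  moreover have "(\<lambda>k. norm (f (m, k))) summable_on UNIV" for m
    using abs[of m] by (rule has_sum_imp_summable)
  ultimately have "(\<lambda>x. norm (f x)) summable_on UNIV \<times> UNIV"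
    by (intro Infinite_Sum.abs_summable_on_Sigma_iff[THEN iffD2]) simp
  hence "f summable_on UNIV \<times> UNIV" by (rule Infinite_Sum.abs_summable_summable)
  then obtain F where F: "(f has_sum F) (UNIV \<times> UNIV)" by (auto simp: summable_on_def)
  have "((\<lambda>m. of_real (b m) * (z ^ m / (1 - z) ^ (m + N + 1))) has_sum F) UNIV"
    by (rule has_sum_SigmaD[OF F]) (rule inner)
  hence "(\<lambda>m. of_real (b m) * (z ^ m / (1 - z) ^ (m + N + 1))) sums F" by (rule has_sum_imp_sums)
  hence 1: "(\<lambda>m. of_real (b m) * (z / (1 - z)) ^ m / (1 - z) ^ Suc N) sums F"
    by (simp add: power_divide power_add mult_ac)
  have nrm: "norm (of_real (b m) * (z / (1 - z)) ^ m) = b m * norm (z / (1 - z)) ^ m" for m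
    using assms(1)[of m] by (simp add: norm_mult norm_power)
  have "summable (\<lambda>m. norm (of_real (b m) * (z / (1 - z)) ^ m))"
    unfolding nrm by (rule assms(2)) simp
  hence "summable (\<lambda>m. of_real (b m) * (z / (1 - z)) ^ m)"
    by (rule summable_norm_cancel)
  hence "(\<lambda>m. of_real (b m) * (z / (1 - z)) ^ m / (1 - z) ^ Suc N) sums
      ((\<Sum>m. of_real (b m) * (z / (1 - z)) ^ m) / (1 - z) ^ Suc N)"
    by (intro sums_divide summable_sums)
  with 1 have F_eq: "F = (\<Sum>m. of_real (b m) * (z / (1 - z)) ^ m) / (1 - z) ^ Suc N"
    by (rule sums_unique2)
  have "((\<lambda>(k, m). f (m, k)) has_sum F) (UNIV \<times> UNIV)"
    by (rule has_sum_swap[THEN iffD1, OF F])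
  hence "((\<lambda>k. of_real (binomial_transform N b k) * z ^ k) has_sum F) UNIV"
  proof (rule has_sum_SigmaD)
    fix k
    have "((\<lambda>m. f (m, k)) has_sum (\<Sum>m\<le>k. f (m, k))) UNIV"
      by (rule has_sum_finite_neutralI) (auto simp: f_def)
    also have "(\<Sum>m\<le>k. f (m, k)) = of_real (binomial_transform N b k) * z ^ k"
      by (simp add: f_def binomial_transform_def sum_distrib_left mult_ac)
    finally show "((\<lambda>y. case (k, y) of (k, m) \<Rightarrow> f (m, k)) has_sum
        (of_real (binomial_transform N b k) * z ^ k)) UNIV" by simp
  qed
  hence "(\<lambda>k. of_real (binomial_transform N b k) * z ^ k) sums F" by (rule has_sum_imp_sums)
  thus ?thesis by (simp only: F_eq)
qed

section \<open>Entire functions with prescribed growth\<close>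

text \<open>
  The terms decrease geometrically in both directions away from the index where \<open>u / 2 ^ j\<close> crosses
  1, so the bound does not depend on \<open>u\<close>.
\<close>
lemma dyadic_sum_bounded:
  fixes u \<gamma> :: real
  assumes "0 < \<gamma>" "0 < u"
  shows "(\<Sum>j<n. if u / 2 ^ j \<le> 1 then u / 2 ^ j else (u / 2 ^ j) powr (- \<gamma>))
           \<le> 2 + 1 / (1 - 2 powr (- \<gamma>))"
proof -
  define \<phi> where "\<phi> j = (if u / 2 ^ j \<le> 1 then u / 2 ^ j else (u / 2 ^ j) powr (- \<gamma>))" for j :: nat
  define q where "q = 2 powr (- \<gamma>)"
  have q: "0 < q" "q < 1" using assms by (auto simp: q_def powr_minus_divide gr_one_powr)
  obtain j0 where "u < 2 ^ j0" using real_arch_pow[of 2 u] by auto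
  hence ex: "\<exists>j. u \<le> 2 ^ j" by (auto intro: less_imp_le)
  define N where "N = (LEAST j. u \<le> 2 ^ j)"
  have N: "u \<le> 2 ^ N" unfolding N_def using ex by (rule LeastI_ex)
  have N_min: "2 ^ j < u" if "j < N" for j :: nat using not_less_Least[of j "\<lambda>j. u \<le> 2 ^ j"] that by (auto simp: N_def)
  have geom: "(\<Sum>i<k. s ^ i) \<le> 1 / (1 - s)" if "0 < s" "s < 1" for s :: real and k
  proof -
    have "(\<Sum>i<k. s ^ i) \<le> (\<Sum>i. s ^ i)"
      by (rule sum_le_suminf) (use that in \<open>auto intro: summable_geometric\<close>)
    thus ?thesis using that by (simp add: suminf_geometric)
  qed
  have large: "\<phi> (N + i) \<le> (1/2) ^ i" for i
  proof -
    have "u / 2 ^ (N + i) \<le> 2 ^ N / 2 ^ (N + i)" using N by (intro divide_right_mono) auto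
    also have "\<dots> = (1/2) ^ i" by (simp add: power_add power_divide)
    finally have *: "u / 2 ^ (N + i) \<le> (1/2) ^ i" .
    also have "(1/2 :: real) ^ i \<le> 1" by (intro power_le_one) auto
    finally show ?thesis using * by (simp add: \<phi>_def)
  qed
  have small: "\<phi> j \<le> q ^ (N - Suc j)" if "j < N" for j
  proof -
    have "2 ^ (N - Suc j) = (2::real) ^ (N - 1) / 2 ^ j" using that by (simp add: power_diff)
    also have "\<dots> \<le> u / 2 ^ j" using N_min[of "N - 1"] that by (intro divide_right_mono) auto
    finally have *: "2 ^ (N - Suc j) \<le> u / 2 ^ j" .
    have "(u / 2 ^ j) powr (- \<gamma>) \<le> (2 ^ (N - Suc j)) powr (- \<gamma>)"
      using * assms(1) by (intro powr_mono2') auto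
    also have "\<dots> = q ^ (N - Suc j)"
      by (simp add: q_def powr_powr mult.commute flip: powr_realpow)
    finally have "(u / 2 ^ j) powr (- \<gamma>) \<le> q ^ (N - Suc j)" .
    moreover have "1 < u / 2 ^ j" using N_min[OF that] by (simp add: field_simps)
    ultimately show ?thesis by (simp add: \<phi>_def)
  qed
  have \<phi>_nonneg: "0 \<le> \<phi> j" for j using assms(2) by (simp add: \<phi>_def)
  have "(\<Sum>j<n. \<phi> j) \<le> (\<Sum>j<N + n. \<phi> j)"
    by (rule sum_mono2) (use \<phi>_nonneg in auto)
  also have "\<dots> = (\<Sum>j<N. \<phi> j) + (\<Sum>i<n. \<phi> (N + i))"
    by (induction n) auto
  also have "(\<Sum>j<N. \<phi> j) \<le> (\<Sum>j<N. q ^ (N - Suc j))" by (intro sum_mono small) auto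
  also have "\<dots> = (\<Sum>j<N. q ^ j)" by (rule sum.nat_diff_reindex)
  also have "\<dots> \<le> 1 / (1 - q)" using q by (rule geom)
  also have "(\<Sum>i<n. \<phi> (N + i)) \<le> (\<Sum>i<n. (1/2) ^ i)" by (intro sum_mono large)
  also have "\<dots> \<le> 1 / (1 - 1/2)" by (rule geom) auto
  finally show ?thesis by (simp add: \<phi>_def q_def)
qed

lemma poly_ge_partial_sum:
  fixes p :: "real poly"
  assumes "\<And>k. 0 \<le> coeff p k" "0 \<le> x" "finite S"
  shows "(\<Sum>k\<in>S. coeff p k * x ^ k) \<le> poly p x"
proof -
  have "(\<Sum>k\<in>S. coeff p k * x ^ k) \<le> (\<Sum>k\<in>S \<union> {..degree p}. coeff p k * x ^ k)"
    by (rule sum_mono2) (use assms in auto)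
  also have "\<dots> = (\<Sum>k\<le>degree p. coeff p k * x ^ k)"
    by (rule sum.mono_neutral_right) (use assms(3) in \<open>auto simp: coeff_eq_0\<close>)
  finally show ?thesis by (simp add: poly_altdef)
qed

lemma PF_polynomial_product:
  fixes Q :: "nat \<Rightarrow> real poly"
  assumes "\<And>j. PF_seq r (coeff (Q j))"
  shows "PF_seq r (coeff (\<Prod>j<n. Q j))"
proof (induction n)
  case 0
  have "coeff (1 :: real poly) = (\<lambda>k. if k = 0 then 1 else 0)" by (auto simp: fun_eq_iff)
  thus ?case using PF_seq_one[of r] by simp
next
  case (Suc n)
  have "coeff ((\<Prod>j<n. Q j) * Q n) = (\<lambda>k. \<Sum>i\<le>k. coeff (\<Prod>j<n. Q j) i * coeff (Q n) (k - i))"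
    by (simp add: fun_eq_iff coeff_mult)
  thus ?case using PF_seq_convolution[OF Suc assms[of n]] by simp
qed

lemma ln_one_plus_le_powr:
  fixes t \<gamma> R :: real
  assumes "0 < \<gamma>" "1 \<le> t" "0 \<le> R"
  shows "ln (1 + R * t) \<le> (1 + R) powr \<gamma> * t powr \<gamma> / \<gamma>"
proof -
  have pos: "0 < 1 + R * t" using assms by (simp add: add_pos_nonneg)
  have "\<gamma> * ln (1 + R * t) = ln ((1 + R * t) powr \<gamma>)" using pos by (simp add: ln_powr)
  also have "\<dots> \<le> (1 + R * t) powr \<gamma> - 1" by (rule ln_le_minus_one) (use pos in simp)
  also have "\<dots> \<le> (1 + R * t) powr \<gamma>" by simp
  also have "\<dots> \<le> ((1 + R) * t) powr \<gamma>"
    using assms pos by (intro powr_mono2) (auto simp: algebra_simps)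
  also have "\<dots> = (1 + R) powr \<gamma> * t powr \<gamma>" using assms by (simp add: powr_mult)
  finally show ?thesis using assms(1) by (simp add: field_simps)
qed

text \<open>
  From a proximate order only these two inequalities between \<open>V\<close> and powers are used; they say
  that \<open>V\<close> changes by a bounded factor under a bounded change of scale, and by definite powers
  under a large one.
\<close>
locale regular_growth =
  fixes V :: "real \<Rightarrow> real" and \<alpha> \<beta> X :: real
  assumes exponents: "0 < \<alpha>" "0 < \<beta>" and X: "1 \<le> X"
    and V_pos: "\<And>x. X \<le> x \<Longrightarrow> 0 < V x"
    and V_lower: "\<And>x y. X \<le> y \<Longrightarrow> y \<le> x \<Longrightarrow> V y * (x / y) powr \<alpha> \<le> V x"
    and V_upper: "\<And>x y. X \<le> y \<Longrightarrow> y \<le> x \<Longrightarrow> V x \<le> V y * (x / y) powr \<beta>"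
begin

lemma V_mono: "X \<le> y \<Longrightarrow> y \<le> x \<Longrightarrow> V y \<le> V x"
proof -
  assume *: "X \<le> y" "y \<le> x"
  have "1 \<le> (x / y) powr \<alpha>" using * X exponents by (intro ge_one_powr_ge_zero) auto
  hence "V y * 1 \<le> V y * (x / y) powr \<alpha>" using V_pos[OF *(1)] by (intro mult_left_mono) auto
  thus ?thesis using V_lower[OF *] by simp
qed

lemma V_at_top: "filterlim V at_top at_top"
proof (rule filterlim_at_top_mono)
  have "filterlim (\<lambda>x. x powr \<alpha>) at_top at_top" using exponents by real_asymp
  hence "filterlim (\<lambda>x. V X * X powr (- \<alpha>) * x powr \<alpha>) at_top at_top"
    using V_pos[of X] X by (intro filterlim_tendsto_pos_mult_at_top[OF tendsto_const]) auto
  thus "filterlim (\<lambda>x. V X * X powr (- \<alpha>) * x powr \<alpha>) at_top at_top" .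
  show "\<forall>\<^sub>F x in at_top. V X * X powr (- \<alpha>) * x powr \<alpha> \<le> V x"
    using eventually_ge_at_top[of X]
  proof eventually_elim
    case (elim x)
    thus ?case using V_lower[of X x] X by (simp add: powr_divide powr_minus field_simps)
  qed
qed

text \<open>
  The contribution of the block at scale \<open>y\<close> to the logarithm at \<open>x\<close>, for \<open>x\<close> beyond
  \<open>y / (2 * R)\<close>. If \<open>x \<ge> y\<close>, the logarithm costs only half of the gain \<open>(x / y) powr \<alpha>\<close> of \<open>V x\<close>
  over \<open>V y\<close>. If \<open>x < y\<close>, the two scales are comparable and a constant depending on \<open>R\<close> and
  \<open>\<beta>\<close> suffices.
\<close>
lemma block_bound:
  assumes "1 \<le> R" "X \<le> x" "X \<le> y" "1 < 2 * R * (x / y)"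
  shows "V y * ln (1 + R * (x / y)) \<le>
    ((2 * R * (1 + R)) powr (\<alpha> / 2) / (\<alpha> / 2) + R * (2 * R) powr \<beta> * (2 * R) powr (\<alpha> / 2)) *
    V x * (2 * R * (x / y)) powr (- (\<alpha> / 2))"
proof -
  define t where "t = x / y"
  define \<gamma> where "\<gamma> = \<alpha> / 2"
  have pos: "0 < x" "0 < y" "0 < t" "0 < \<gamma>" "0 < R" using assms X exponents by (auto simp: t_def \<gamma>_def)
  have Vx: "0 < V x" and Vy: "0 < V y" using assms V_pos by auto
  have neg: "(2 * R * t) powr (- \<gamma>) = (2 * R) powr (- \<gamma>) * t powr (- \<gamma>)"
    using pos by (simp add: powr_mult)
  have cancel: "(2 * R) powr \<gamma> * (2 * R) powr (- \<gamma>) = 1"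
    using pos by (simp flip: powr_add)
  define A where "A = (2 * R * (1 + R)) powr \<gamma> / \<gamma>"
  define B where "B = R * (2 * R) powr \<beta> * (2 * R) powr \<gamma>"
  have AB: "0 \<le> A" "0 \<le> B" using pos by (auto simp: A_def B_def)
  have rhs_mono: "D * V x * (2 * R * t) powr (- \<gamma>) \<le> (A + B) * V x * (2 * R * t) powr (- \<gamma>)"
    if "D = A \<or> D = B" for D
    using that AB Vx by (intro mult_right_mono) auto
  have "V y * ln (1 + R * t) \<le> (A + B) * V x * (2 * R * t) powr (- \<gamma>)"
  proof (cases "1 \<le> t")
    case True
    hence "y \<le> x" using pos by (simp add: t_def field_simps)
    have "V y * ln (1 + R * t) \<le> V y * ((1 + R) powr \<gamma> * t powr \<gamma> / \<gamma>)"
      using Vy True pos by (intro mult_left_mono ln_one_plus_le_powr) auto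
    also have "\<dots> = (V y * t powr \<alpha>) * ((1 + R) powr \<gamma> / \<gamma>) * t powr (- \<gamma>)"
    proof -
      have "t powr \<gamma> = t powr \<alpha> * t powr (- \<gamma>)" by (simp add: \<gamma>_def flip: powr_add)
      thus ?thesis by simp
    qed
    also have "\<dots> \<le> V x * ((1 + R) powr \<gamma> / \<gamma>) * t powr (- \<gamma>)"
      using V_lower[OF assms(3) \<open>y \<le> x\<close>] pos by (intro mult_right_mono) (auto simp: t_def)
    also have "\<dots> = A * V x * (2 * R * t) powr (- \<gamma>)"
    proof -
      have A: "A = (2 * R) powr \<gamma> * ((1 + R) powr \<gamma> / \<gamma>)" using pos by (simp add: A_def powr_mult)
      have "A * (2 * R * t) powr (- \<gamma>) =
          ((2 * R) powr \<gamma> * (2 * R) powr (- \<gamma>)) * ((1 + R) powr \<gamma> / \<gamma>) * t powr (- \<gamma>)"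
        unfolding neg A by (simp only: mult_ac)
      hence E: "A * (2 * R * t) powr (- \<gamma>) = ((1 + R) powr \<gamma> / \<gamma>) * t powr (- \<gamma>)"
        by (simp only: cancel mult_1_left)
      have F: "A * V x * (2 * R * t) powr (- \<gamma>) = V x * (A * (2 * R * t) powr (- \<gamma>))"
        by (simp only: mult_ac)
      show ?thesis unfolding F E by (simp only: mult_ac)
    qed
    also note rhs_mono[of A]
    finally show ?thesis by simp
  next
    case False
    hence "x \<le> y" using pos by (simp add: t_def field_simps)
    have "ln (1 + R * t) \<le> R * t" using pos by (intro ln_add_one_self_le_self) auto
    also have "\<dots> \<le> R * 1" using False pos by (intro mult_left_mono) auto
    finally have ln: "ln (1 + R * t) \<le> R" by simp
    have "y / x = 1 / t" by (simp add: t_def)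
    also have "\<dots> \<le> 2 * R" using assms(4) pos by (simp add: t_def[symmetric] field_simps)
    finally have "(y / x) powr \<beta> \<le> (2 * R) powr \<beta>" using pos exponents by (intro powr_mono2) auto
    hence "V y \<le> V x * (2 * R) powr \<beta>"
      using V_upper[OF assms(2) \<open>x \<le> y\<close>] Vx by (meson mult_left_mono less_imp_le order_trans)
    hence "V y * ln (1 + R * t) \<le> (V x * (2 * R) powr \<beta>) * R"
      using ln Vy Vx pos by (intro mult_mono) auto
    also have "\<dots> \<le> (V x * (2 * R) powr \<beta>) * R * t powr (- \<gamma>)"
    proof -
      have "1 \<le> t powr (- \<gamma>)"
        using False pos powr_mono2'[of "- \<gamma>" t 1] by simp
      thus ?thesis using Vx pos mult_left_mono[of 1 "t powr (- \<gamma>)" "V x * (2 * R) powr \<beta> * R"] by simp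
    qed
    also have "\<dots> = B * V x * (2 * R * t) powr (- \<gamma>)"
    proof -
      have "B * (2 * R * t) powr (- \<gamma>) =
          ((2 * R) powr \<gamma> * (2 * R) powr (- \<gamma>)) * (R * (2 * R) powr \<beta>) * t powr (- \<gamma>)"
        unfolding neg B_def by (simp only: mult_ac)
      hence E: "B * (2 * R * t) powr (- \<gamma>) = (R * (2 * R) powr \<beta>) * t powr (- \<gamma>)"
        by (simp only: cancel mult_1_left)
      have F: "B * V x * (2 * R * t) powr (- \<gamma>) = V x * (B * (2 * R * t) powr (- \<gamma>))"
        by (simp only: mult_ac)
      show ?thesis unfolding F E by (simp only: mult_ac)
    qed
    also note rhs_mono[of B]
    finally show ?thesis by simp
  qed
  thus ?thesis by (simp only: A_def B_def t_def \<gamma>_def)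
qed

text \<open>
  At \<open>x\<close>, blocks with \<open>y j\<close> much larger than \<open>x\<close> are controlled by the geometric bound on their
  coefficients, the others by their degree; \<open>dyadic_sum_bounded\<close> adds up the estimates.
  From below, the leading coefficient 1 of the block with \<open>2 * y n \<le> x < 4 * y n\<close> already
  gives \<open>2 ^ d n\<close>. The coefficients of the partial products increase with \<open>n\<close>, and their limits
  are the coefficients \<open>b\<close>, so that no infinite product of functions is needed.
\<close>
theorem entire_PF_function_of_growth:
  assumes "1 \<le> r"
  obtains b c C x0 where "PF_seq r b" "b 0 = 1" "\<And>k. 0 \<le> b k"
    "\<And>x. 0 \<le> x \<Longrightarrow> summable (\<lambda>k. b k * x ^ k)" "0 < c" "X \<le> x0"
    "\<And>x. x0 \<le> x \<Longrightarrow> exp (c * V x) \<le> (\<Sum>k. b k * x ^ k)"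
    "\<And>x. x0 \<le> x \<Longrightarrow> (\<Sum>k. b k * x ^ k) \<le> exp (C * V x)"
proof -
  have "\<forall>\<^sub>F x in at_top. 1 \<le> V x \<and> X \<le> x"
    using V_at_top unfolding filterlim_at_top by (intro eventually_conj eventually_ge_at_top) auto
  then obtain Y where Y: "1 \<le> V Y" "X \<le> Y" by (auto simp: eventually_at_top_linorder)
  have Y_pos: "0 < Y" using X Y by simp
  define y where "y j = Y * 2 ^ j" for j :: nat
  have yY: "Y \<le> y j" for j using Y_pos by (simp add: y_def)
  have y_pos: "0 < y j" for j using Y_pos by (simp add: y_def)
  have yX: "X \<le> y j" for j using yY Y(2) by (rule order_trans[rotated])
  have Vy: "1 \<le> V (y j)" for j using V_mono[OF Y(2) yY] Y(1) by (rule order_trans[rotated])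
  define d where "d j = nat \<lfloor>V (y j)\<rfloor>" for j
  have d_le: "real (d j) \<le> V (y j)" and d_ge: "V (y j) / 2 \<le> real (d j)" for j
  proof -
    have "real (d j) = of_int \<lfloor>V (y j)\<rfloor>" "1 \<le> \<lfloor>V (y j)\<rfloor>" using Vy[of j] by (auto simp: d_def)
    thus "real (d j) \<le> V (y j)" "V (y j) / 2 \<le> real (d j)" by linarith+
  qed
  have "\<forall>j. \<exists>a. PF_seq r a \<and> a 0 = 1 \<and> a (d j) = 1 \<and> (\<forall>k>d j. a k = 0) \<and>
      (\<forall>k. 0 \<le> a k) \<and> (\<forall>k. a k \<le> real r ^ k)"
  proof
    fix j
    show "\<exists>a. PF_seq r a \<and> a 0 = 1 \<and> a (d j) = 1 \<and> (\<forall>k>d j. a k = 0) \<and>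
      (\<forall>k. 0 \<le> a k) \<and> (\<forall>k. a k \<le> real r ^ k)"
      by (rule PF_polynomial_small_linear_term[OF assms, of "d j"]) blast
  qed
  from choice[OF this] obtain a where "\<forall>j. PF_seq r (a j) \<and> a j 0 = 1 \<and> a j (d j) = 1 \<and>
      (\<forall>k>d j. a j k = 0) \<and> (\<forall>k. 0 \<le> a j k) \<and> (\<forall>k. a j k \<le> real r ^ k)" ..
  hence a: "\<And>j. PF_seq r (a j)" "\<And>j. a j 0 = 1" "\<And>j. a j (d j) = 1"
    "\<And>j k. k > d j \<Longrightarrow> a j k = 0" "\<And>j k. 0 \<le> a j k" "\<And>j k. a j k \<le> real r ^ k"
    by auto
  define Q where "Q j = Abs_poly (\<lambda>k. inverse (y j) ^ k * a j k)" for j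
  have Q: "coeff (Q j) = (\<lambda>k. inverse (y j) ^ k * a j k)" for j
    unfolding Q_def by (rule coeff_Abs_poly[of "d j"]) (simp add: a(4))
  have Q_nonneg: "0 \<le> coeff (Q j) k" for j k using y_pos[of j] a(5) by (simp add: Q)
  have Q0: "coeff (Q j) 0 = 1" for j by (simp add: Q a(2))
  have Q_eval: "poly (Q j) x = (\<Sum>k\<le>d j. a j k * (x / y j) ^ k)" for j x
  proof -
    have "degree (Q j) \<le> d j" by (rule degree_le) (simp add: Q a(4))
    hence "poly (Q j) x = (\<Sum>k\<le>d j. coeff (Q j) k * x ^ k)"
      unfolding poly_altdef by (intro sum.mono_neutral_left) (auto simp: coeff_eq_0)
    thus ?thesis by (simp add: Q divide_inverse power_mult_distrib mult_ac)
  qed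
  define R where "R = real r"
  have R: "1 \<le> R" using assms by (simp add: R_def)
  have Q_one: "1 \<le> poly (Q j) x" if "0 \<le> x" for j x
    using poly_ge_partial_sum[of "Q j" x "{0}"] that Q_nonneg Q0 by simp
  have Q_geom: "poly (Q j) x \<le> (\<Sum>k\<le>d j. (R * (x / y j)) ^ k)" if "0 \<le> x" for j x
    unfolding Q_eval power_mult_distrib R_def
    using that y_pos[of j] by (intro sum_mono mult_right_mono a) auto
  have Q_far: "poly (Q j) x \<le> exp (2 * R * (x / y j))" if "0 \<le> x" "2 * R * (x / y j) \<le> 1" for j x
  proof -
    define s where "s = R * (x / y j)"
    have s: "0 \<le> s" "s \<le> 1/2" using that y_pos[of j] R by (auto simp: s_def)
    have "poly (Q j) x \<le> (\<Sum>k\<le>d j. s ^ k)" unfolding s_def by (rule Q_geom[OF that(1)])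
    also have "\<dots> \<le> (\<Sum>k. s ^ k)"
      by (rule sum_le_suminf) (use s in \<open>auto intro: summable_geometric\<close>)
    also have "\<dots> = 1 / (1 - s)" using s by (intro suminf_geometric) auto
    also have "\<dots> \<le> 1 + 2 * s"
    proof -
      have "s * s \<le> s * (1/2)" using s by (intro mult_left_mono) auto
      hence "1 \<le> (1 + 2 * s) * (1 - s)" by (simp add: algebra_simps)
      thus ?thesis using s by (simp add: divide_le_eq)
    qed
    also have "\<dots> \<le> exp (2 * s)" by (rule exp_ge_add_one_self)
    finally show ?thesis by (simp add: s_def mult_ac)
  qed
  have Q_near: "poly (Q j) x \<le> exp (V (y j) * ln (1 + R * (x / y j)))" if "0 \<le> x" for j x
  proof -
    define s where "s = R * (x / y j)"
    have s: "0 \<le> s" using that y_pos[of j] R by (auto simp: s_def)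
    have "poly (Q j) x \<le> (\<Sum>k\<le>d j. s ^ k)" unfolding s_def by (rule Q_geom[OF that])
    also have "\<dots> \<le> (\<Sum>k\<le>d j. of_nat (d j choose k) * s ^ k)"
    proof (rule sum_mono)
      fix k assume "k \<in> {..d j}"
      hence "1 \<le> real (d j choose k)" by (simp add: Suc_leI)
      from mult_right_mono[OF this, of "s ^ k"] show "s ^ k \<le> of_nat (d j choose k) * s ^ k" using s by simp
    qed
    also have "\<dots> = (1 + s) ^ d j"
      using binomial_ring[of s 1 "d j"] by (simp add: add.commute)
    also have "\<dots> = exp (real (d j) * ln (1 + s))" using s by (simp add: exp_of_nat_mult)
    also have "\<dots> \<le> exp (V (y j) * ln (1 + s))" using d_le[of j] s by (simp add: mult_right_mono)
    finally show ?thesis by (simp add: s_def)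
  qed
  define \<gamma> where "\<gamma> = \<alpha> / 2"
  have \<gamma>: "0 < \<gamma>" using exponents by (simp add: \<gamma>_def)
  define D where "D = 1 + (2 * R * (1 + R)) powr \<gamma> / \<gamma> + R * (2 * R) powr \<beta> * (2 * R) powr \<gamma>"
  define C where "C = D * (2 + 1 / (1 - 2 powr (- \<gamma>)))"
  define \<phi> where "\<phi> x j = (if 2 * R * (x / Y) / 2 ^ j \<le> 1 then 2 * R * (x / Y) / 2 ^ j
      else (2 * R * (x / Y) / 2 ^ j) powr (- \<gamma>))" for x and j :: nat
  have D: "1 \<le> D" using R \<gamma> by (simp add: D_def)
  have Q_bound: "poly (Q j) x \<le> exp (D * V x * \<phi> x j)" if "Y \<le> x" for j x
  proof -
    have x: "0 < x" "X \<le> x" using that Y_pos Y(2) by auto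
    have Vx: "1 \<le> V x" using V_mono[OF Y(2) that] Y(1) by simp
    have eq: "2 * R * (x / Y) / 2 ^ j = 2 * R * (x / y j)" by (simp add: y_def)
    show ?thesis
    proof (cases "2 * R * (x / y j) \<le> 1")
      case True
      have "1 * (2 * R * (x / y j)) \<le> (D * V x) * (2 * R * (x / y j))"
        using mult_mono[of 1 D 1 "V x"] D Vx R x y_pos[of j] by (intro mult_right_mono) auto
      moreover have "\<phi> x j = 2 * R * (x / y j)" using True by (simp only: \<phi>_def eq if_True)
      ultimately have "exp (2 * R * (x / y j)) \<le> exp (D * V x * \<phi> x j)" by simp
      with Q_far[of x j] x True show ?thesis by linarith
    next
      case False
      have "V (y j) * ln (1 + R * (x / y j)) \<le> (D - 1) * V x * (2 * R * (x / y j)) powr (- \<gamma>)"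
        using block_bound[OF R x(2) yX[of j]] False by (simp add: D_def \<gamma>_def)
      also have "\<dots> \<le> D * V x * (2 * R * (x / y j)) powr (- \<gamma>)"
        using Vx by (intro mult_right_mono) auto
      also have "(2 * R * (x / y j)) powr (- \<gamma>) = \<phi> x j" using False by (simp only: \<phi>_def eq if_False)
      finally have "exp (V (y j) * ln (1 + R * (x / y j))) \<le> exp (D * V x * \<phi> x j)" by simp
      with Q_near[of x j] x show ?thesis by linarith
    qed
  qed
  define \<Psi> where "\<Psi> n = (\<Prod>j<n. Q j)" for n
  have \<Psi>_Suc: "\<Psi> (Suc n) = \<Psi> n * Q n" for n by (simp add: \<Psi>_def)
  have \<Psi>_eval: "poly (\<Psi> n) x = (\<Prod>j<n. poly (Q j) x)" for n x by (simp add: \<Psi>_def poly_prod)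
  have \<Psi>_bound: "poly (\<Psi> n) x \<le> exp (C * V x)" if "Y \<le> x" for n x
  proof -
    have x: "0 < x" using that Y_pos by auto
    have Vx: "1 \<le> V x" using V_mono[OF Y(2) that] Y(1) by simp
    have "poly (\<Psi> n) x \<le> (\<Prod>j<n. exp (D * V x * \<phi> x j))"
      unfolding \<Psi>_eval using Q_bound[OF that] Q_one[of x] x
      by (intro prod_mono) (auto intro: order_trans[OF zero_le_one])
    also have "\<dots> = exp (D * V x * (\<Sum>j<n. \<phi> x j))"
      by (simp add: exp_sum[symmetric] sum_distrib_left)
    also have "\<dots> \<le> exp (D * V x * (2 + 1 / (1 - 2 powr (- \<gamma>))))"
    proof -
      have "0 < 2 * R * (x / Y)" using R x Y_pos by simp
      from dyadic_sum_bounded[OF \<gamma> this, of n]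
      have "(\<Sum>j<n. \<phi> x j) \<le> 2 + 1 / (1 - 2 powr (- \<gamma>))" by (simp only: \<phi>_def)
      thus ?thesis using D Vx by (simp add: mult_left_mono)
    qed
    also have "\<dots> = exp (C * V x)" by (simp add: C_def mult_ac)
    finally show ?thesis .
  qed
  have \<Psi>_nonneg: "0 \<le> coeff (\<Psi> n) k" for n k
    by (induction n arbitrary: k)
       (auto simp: \<Psi>_Suc coeff_mult Q_nonneg intro!: sum_nonneg, auto simp: \<Psi>_def)
  have \<Psi>0: "coeff (\<Psi> n) 0 = 1" for n
    by (induction n) (auto simp: \<Psi>_Suc coeff_mult Q0, auto simp: \<Psi>_def)
  have \<Psi>_step: "coeff (\<Psi> n) k \<le> coeff (\<Psi> (Suc n)) k" for n k
  proof -
    have "coeff (\<Psi> n) k * coeff (Q n) (k - k) \<le> (\<Sum>i\<le>k. coeff (\<Psi> n) i * coeff (Q n) (k - i))"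
      by (rule member_le_sum[where f = "\<lambda>i. coeff (\<Psi> n) i * coeff (Q n) (k - i)"])
         (auto simp: \<Psi>_nonneg Q_nonneg)
    thus ?thesis by (simp add: \<Psi>_Suc coeff_mult Q0)
  qed
  have mono: "incseq (\<lambda>n. coeff (\<Psi> n) k)" for k by (rule incseq_SucI) (rule \<Psi>_step)
  have partial: "(\<Sum>k\<in>S. coeff (\<Psi> n) k * x ^ k) \<le> exp (C * V (max x Y))"
    if "0 \<le> x" "finite S" for S x n
  proof -
    have "(\<Sum>k\<in>S. coeff (\<Psi> n) k * x ^ k) \<le> (\<Sum>k\<in>S. coeff (\<Psi> n) k * (max x Y) ^ k)"
      using that \<Psi>_nonneg by (intro sum_mono mult_left_mono power_mono) auto
    also have "\<dots> \<le> poly (\<Psi> n) (max x Y)"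
      using that \<Psi>_nonneg by (intro poly_ge_partial_sum) auto
    also have "\<dots> \<le> exp (C * V (max x Y))" by (rule \<Psi>_bound) simp
    finally show ?thesis .
  qed
  have "\<exists>L. (\<lambda>n. coeff (\<Psi> n) k) \<longlonglongrightarrow> L" for k
  proof -
    have "coeff (\<Psi> n) k \<le> exp (C * V (max 1 Y))" for n using partial[of 1 "{k}" n] by simp
    thus ?thesis using incseq_convergent[OF mono[of k]] by metis
  qed
  then obtain b where b: "\<And>k. (\<lambda>n. coeff (\<Psi> n) k) \<longlonglongrightarrow> b k" by metis
  have b_ge: "coeff (\<Psi> n) k \<le> b k" for n k by (rule incseq_le[OF mono b])
  have b_nonneg: "0 \<le> b k" for k using b_ge[of 0 k] \<Psi>_nonneg[of 0 k] by linarith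
  have b_partial: "(\<Sum>k<K. b k * x ^ k) \<le> exp (C * V (max x Y))" if "0 \<le> x" for K x
  proof (rule LIMSEQ_le_const2)
    show "(\<lambda>n. \<Sum>k<K. coeff (\<Psi> n) k * x ^ k) \<longlonglongrightarrow> (\<Sum>k<K. b k * x ^ k)"
      by (intro tendsto_sum tendsto_mult b tendsto_const)
  qed (use partial[OF that] in auto)
  have summable: "summable (\<lambda>k. b k * x ^ k)" if "0 \<le> x" for x
    by (rule summableI_nonneg_bounded[OF _ b_partial[OF that]]) (use b_nonneg that in auto)
  have suminf_ge: "poly (\<Psi> n) x \<le> (\<Sum>k. b k * x ^ k)" if "0 \<le> x" for n x
  proof -
    have "poly (\<Psi> n) x = (\<Sum>k\<le>degree (\<Psi> n). coeff (\<Psi> n) k * x ^ k)" by (simp add: poly_altdef)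
    also have "\<dots> \<le> (\<Sum>k\<le>degree (\<Psi> n). b k * x ^ k)"
      using that b_ge by (intro sum_mono mult_right_mono) auto
    also have "\<dots> \<le> (\<Sum>k. b k * x ^ k)"
      by (rule sum_le_suminf[OF summable[OF that]]) (use b_nonneg that in auto)
    finally show ?thesis .
  qed
  define c where "c = ln 2 / 2 * 4 powr (- \<beta>)"
  have lower: "exp (c * V x) \<le> (\<Sum>k. b k * x ^ k)" if "2 * Y \<le> x" for x
  proof -
    have x: "0 < x" "Y \<le> x" using that Y_pos by auto
    have Vx: "0 < V x" using V_pos x(2) Y(2) by auto
    define n where "n = nat \<lfloor>log 2 (x / (2 * Y))\<rfloor>"
    have M: "1 \<le> x / (2 * Y)" using that Y_pos by simp
    hence log: "0 \<le> log 2 (x / (2 * Y))" by simp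
    have n: "real n \<le> log 2 (x / (2 * Y))" "log 2 (x / (2 * Y)) < real n + 1"
      using log unfolding n_def by linarith+
    have "2 ^ n \<le> x / (2 * Y)" using n(1) M by (simp add: le_log_iff powr_realpow)
    hence n1: "2 * y n \<le> x" using Y_pos by (simp add: y_def field_simps)
    have "x / (2 * Y) < 2 powr (real n + 1)" using n(2) M by (simp add: log_less_iff)
    hence "x / (2 * Y) < 2 * 2 ^ n" by (simp add: powr_add powr_realpow)
    hence n2: "x < 4 * y n" using Y_pos by (simp add: y_def field_simps)
    have "V x \<le> V (y n) * (x / y n) powr \<beta>" using n1 y_pos[of n] yX by (intro V_upper) auto
    also have "\<dots> \<le> V (y n) * 4 powr \<beta>"
      using n2 x y_pos[of n] exponents Vy[of n]
      by (intro mult_left_mono powr_mono2) (auto simp: field_simps)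
    finally have "V x * 4 powr (- \<beta>) \<le> V (y n)" by (simp add: powr_minus field_simps)
    hence "c * V x \<le> V (y n) / 2 * ln 2" by (simp add: c_def field_simps)
    also have "\<dots> \<le> real (d n) * ln 2" using d_ge[of n] by (intro mult_right_mono) auto
    finally have "exp (c * V x) \<le> exp (real (d n) * ln 2)" by simp
    also have "\<dots> = 2 ^ d n" by (simp add: exp_of_nat_mult)
    also have "\<dots> \<le> (x / y n) ^ d n" using n1 y_pos[of n] by (intro power_mono) (auto simp: field_simps)
    also have "\<dots> = (\<Sum>k\<in>{d n}. coeff (Q n) k * x ^ k)"
      by (simp add: Q a(3) divide_inverse power_mult_distrib mult_ac)
    also have "\<dots> \<le> poly (Q n) x" using Q_nonneg x by (intro poly_ge_partial_sum) auto
    also have "\<dots> \<le> poly (\<Psi> n) x * poly (Q n) x"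
    proof -
      have "1 \<le> poly (\<Psi> n) x" unfolding \<Psi>_eval using Q_one x by (intro prod_ge_1) auto
      from mult_right_mono[OF this, of "poly (Q n) x"] show ?thesis using Q_one[of x n] x by simp
    qed
    also have "\<dots> = poly (\<Psi> (Suc n)) x" by (simp add: \<Psi>_Suc)
    also have "\<dots> \<le> (\<Sum>k. b k * x ^ k)" using x by (intro suminf_ge) auto
    finally show ?thesis .
  qed
  show ?thesis
  proof (rule that[of b c "2 * Y" C])
    have "PF_seq r (coeff (Q j))" for j
      unfolding Q by (rule PF_seq_scale[OF a(1)]) (simp add: y_pos)
    hence "PF_seq r (coeff (\<Psi> n))" for n unfolding \<Psi>_def by (rule PF_polynomial_product)
    thus "PF_seq r b" using b by (rule PF_seq_limit)
    show "b 0 = 1" using b[of 0] by (simp add: \<Psi>0 LIMSEQ_const_iff)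
    show "0 < c" by (simp add: c_def)
    show "X \<le> 2 * Y" using Y Y_pos by simp
    fix x assume "2 * Y \<le> x"
    hence "0 \<le> x" "max x Y = x" using Y_pos by auto
    thus "(\<Sum>k. b k * x ^ k) \<le> exp (C * V x)"
      using suminf_le_const[OF summable, of x "exp (C * V x)"] b_partial[of x] by simp
  qed (use b_nonneg summable lower in auto)
qed

end

section \<open>Proximate orders and the main construction\<close>

text \<open>
  The logarithmic derivative of \<open>x powr \<rho> x\<close>, multiplied by \<open>x\<close>, is \<open>\<rho> x + x * \<rho>' x * ln x\<close> and
  tends to \<open>l\<close>; the exponents \<open>l / 2\<close> and \<open>2 * l\<close> are any two numbers enclosing \<open>l\<close>.
\<close>
lemma proximate_order_regular_growth:
  assumes "proximate_order \<rho>" "(\<rho> \<longlongrightarrow> l) at_top" "0 < l"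
  obtains X where "regular_growth (prox_V \<rho>) (l / 2) (2 * l) X"
proof -
  obtain \<rho>' where \<rho>': "\<And>x. 0 \<le> x \<Longrightarrow> (\<rho> has_real_derivative \<rho>' x) (at x within {0..})"
    "((\<lambda>x. x * (\<rho>' x / \<rho> x) * ln x) \<longlongrightarrow> 0) at_top"
    using assms(1) unfolding proximate_order_def by blast
  have "((\<lambda>x. x * (\<rho>' x / \<rho> x) * ln x * \<rho> x + \<rho> x) \<longlongrightarrow> 0 * l + l) at_top"
    by (intro tendsto_intros \<rho>' assms)
  hence lim: "((\<lambda>x. x * (\<rho>' x / \<rho> x) * ln x * \<rho> x + \<rho> x) \<longlongrightarrow> l) at_top" by simp
  have "\<forall>\<^sub>F x in at_top. 0 < \<rho> x \<and> l / 2 < x * (\<rho>' x / \<rho> x) * ln x * \<rho> x + \<rho> x \<and>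
      x * (\<rho>' x / \<rho> x) * ln x * \<rho> x + \<rho> x < 2 * l"
    using assms(3)
    by (intro eventually_conj order_tendstoD[OF assms(2)] order_tendstoD[OF lim]) auto
  then obtain X0 where X0: "\<And>x. X0 \<le> x \<Longrightarrow> 0 < \<rho> x \<and>
      l / 2 < x * (\<rho>' x / \<rho> x) * ln x * \<rho> x + \<rho> x \<and>
      x * (\<rho>' x / \<rho> x) * ln x * \<rho> x + \<rho> x < 2 * l"
    by (auto simp: eventually_at_top_linorder)
  define X where "X = max X0 1"
  define W where "W x = \<rho> x * ln x" for x
  define D where "D x = \<rho>' x * ln x + \<rho> x / x" for x
  have W_deriv: "(W has_real_derivative D x) (at x)" if "0 < x" for x
  proof -
    have "(\<rho> has_real_derivative \<rho>' x) (at x within {0..})" using that by (intro \<rho>'(1)) simp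
    hence "(\<rho> has_real_derivative \<rho>' x) (at x within {0<..})" by (rule DERIV_subset) auto
    hence [derivative_intros]: "(\<rho> has_real_derivative \<rho>' x) (at x)"
      using that by (simp add: at_within_open[of x "{0<..}"])
    show ?thesis
      unfolding W_def D_def by (auto intro!: derivative_eq_intros simp: that divide_inverse)
  qed
  have D_bounds: "l / 2 / x \<le> D x" "D x \<le> 2 * l / x" if "X \<le> x" for x
  proof -
    have x: "X0 \<le> x" "0 < x" using that by (auto simp: X_def)
    have "x * (\<rho>' x / \<rho> x) * ln x * \<rho> x + \<rho> x = x * D x"
      using X0[OF x(1)] x(2) by (simp add: D_def field_simps)
    thus "l / 2 / x \<le> D x" "D x \<le> 2 * l / x"
      using X0[OF x(1)] x(2) by (auto simp: field_simps)
  qed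
  have V: "prox_V \<rho> x = exp (W x)" if "0 < x" for x
    using that by (simp add: prox_V_def W_def powr_def)
  have X: "1 \<le> X" by (simp add: X_def)
  have ratio: "(x / y) powr e = exp (e * (ln x - ln y))" if "0 < x" "0 < y" for x y e :: real
    using that by (simp add: powr_def ln_div)
  show ?thesis
  proof (rule that[of X], unfold_locales)
    show "0 < prox_V \<rho> x" if "X \<le> x" for x using that X V[of x] by simp
  next
    fix x y assume *: "X \<le> y" "y \<le> x"
    have pos: "0 < y" "0 < x" using * X by auto
    have "W y - l / 2 * ln y \<le> W x - l / 2 * ln x"
    proof (rule DERIV_nonneg_imp_nondecreasing[OF *(2)])
      fix t assume t: "y \<le> t" "t \<le> x"
      have "((\<lambda>t. W t - l / 2 * ln t) has_real_derivative D t - l / 2 / t) (at t)"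
        using DERIV_diff[OF W_deriv[of t] DERIV_cmult[OF DERIV_ln_divide[of t], of "l / 2"]] t pos by simp
      thus "\<exists>z. ((\<lambda>t. W t - l / 2 * ln t) has_real_derivative z) (at t) \<and> 0 \<le> z"
        using D_bounds(1)[of t] t * by auto
    qed
    hence "exp (W y + l / 2 * (ln x - ln y)) \<le> exp (W x)" by (simp add: right_diff_distrib)
    thus "prox_V \<rho> y * (x / y) powr (l / 2) \<le> prox_V \<rho> x"
      by (simp only: V pos ratio exp_add)
    have "2 * l * ln y - W y \<le> 2 * l * ln x - W x"
    proof (rule DERIV_nonneg_imp_nondecreasing[OF *(2)])
      fix t assume t: "y \<le> t" "t \<le> x"
      have "((\<lambda>t. 2 * l * ln t - W t) has_real_derivative 2 * l / t - D t) (at t)"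
        using DERIV_diff[OF DERIV_cmult[OF DERIV_ln_divide[of t], of "2 * l"] W_deriv[of t]] t pos by simp
      thus "\<exists>z. ((\<lambda>t. 2 * l * ln t - W t) has_real_derivative z) (at t) \<and> 0 \<le> z"
        using D_bounds(2)[of t] t * by auto
    qed
    hence "exp (W x) \<le> exp (W y + 2 * l * (ln x - ln y))" by (simp add: right_diff_distrib)
    thus "prox_V \<rho> x \<le> prox_V \<rho> y * (x / y) powr (2 * l)"
      by (simp only: V pos ratio exp_add)
  qed (use assms X in auto)
qed

context regular_growth
begin

text \<open>
  The powers of \<open>w\<close> in front of \<open>\<psi>\<close>, and the bound at a pole, change the logarithm of the modulus by a
  multiple of \<open>ln x\<close>; this makes such terms harmless.
\<close>
lemma ln_negligible: "((\<lambda>x. ln x / V x) \<longlongrightarrow> 0) at_top"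
proof (rule Lim_null_comparison)
  define k where "k = V X * X powr (- \<alpha>)"
  have k: "0 < k" using V_pos[of X] X by (simp add: k_def)
  show "((\<lambda>x. ln x / (k * x powr \<alpha>)) \<longlongrightarrow> 0) at_top" using k exponents by real_asymp
  show "\<forall>\<^sub>F x in at_top. norm (ln x / V x) \<le> ln x / (k * x powr \<alpha>)"
    using eventually_ge_at_top[of X]
  proof eventually_elim
    case (elim x)
    have "k * x powr \<alpha> \<le> V x"
      using V_lower[of X x] elim X by (simp add: k_def powr_divide powr_minus field_simps)
    hence "ln x / V x \<le> ln x / (k * x powr \<alpha>)"
      using k X elim V_pos[OF elim] by (intro divide_left_mono mult_pos_pos) auto
    moreover have "0 \<le> ln x / V x" using V_pos[OF elim] X elim by simp
    ultimately show ?case by simp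
  qed
qed

lemma V_double: "X \<le> y \<Longrightarrow> y \<le> x \<Longrightarrow> x \<le> 2 * y \<Longrightarrow> V x \<le> V y * 2 powr \<beta>"
proof -
  assume *: "X \<le> y" "y \<le> x" "x \<le> 2 * y"
  have "(x / y) powr \<beta> \<le> 2 powr \<beta>" using * X exponents by (intro powr_mono2) (auto simp: field_simps)
  hence "V y * (x / y) powr \<beta> \<le> V y * 2 powr \<beta>" using V_pos[OF *(1)] by (intro mult_left_mono) auto
  thus ?thesis using V_upper[OF *(1,2)] by linarith
qed

end

lemma Limsup_pos_finite:
  fixes f :: "'a \<Rightarrow> real"
  assumes "F \<noteq> bot" "0 < c" "\<forall>\<^sub>F x in F. c \<le> f x \<and> f x \<le> C"
  shows "let L = Limsup F (\<lambda>x. ereal (f x)) in 0 < L \<and> L < \<infinity>"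
proof -
  have "ereal c \<le> Limsup F (\<lambda>x. ereal (f x))"
    by (rule le_Limsup[OF assms(1)]) (use assms(3) in \<open>auto elim: eventually_mono\<close>)
  moreover have "Limsup F (\<lambda>x. ereal (f x)) \<le> ereal C"
    by (rule Limsup_bounded) (use assms(3) in \<open>auto elim: eventually_mono\<close>)
  moreover have "0 < ereal c" "ereal C < \<infinity>" using assms(2) by auto
  ultimately show ?thesis unfolding Let_def by (metis order_less_le_trans order_le_less_trans)
qed

lemma max_mod_between:
  assumes "s \<in> S" "\<And>z. z \<in> S \<Longrightarrow> cmod (g z) \<le> B"
  shows "cmod (g s) \<le> max_mod g S" "max_mod g S \<le> B"
proof -
  have "bdd_above ((\<lambda>z. cmod (g z)) ` S)" by (rule bdd_aboveI2) (rule assms(2))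
  thus "cmod (g s) \<le> max_mod g S" unfolding max_mod_def using assms(1) by (intro cSUP_upper) auto
  show "max_mod g S \<le> B" unfolding max_mod_def using assms by (intro cSUP_least) auto
qed

text \<open>
  Removable singularities and poles both have a finite order, which bounds the growth by a power
  of the distance.
\<close>
lemma not_essential_imp_polynomial_bound:
  fixes G :: "complex \<Rightarrow> complex"
  assumes "isolated_singularity_at G a" "not_essential G a"
  obtains B n \<delta> where "0 < \<delta>" "0 < B" "\<And>z. z \<noteq> a \<Longrightarrow> dist z a < \<delta> \<Longrightarrow> cmod (G z) \<le> B / dist z a ^ n"
proof (cases "\<exists>\<^sub>F z in at a. G z \<noteq> 0")
  case True
  obtain h e where e: "0 < e" "h holomorphic_on cball a e"
    "\<And>z. z \<in> cball a e - {a} \<Longrightarrow> G z = h z * (z - a) powi zorder G a"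
    using zorder_exist[OF assms True] by blast
  have "bounded (h ` cball a e)"
    by (intro compact_imp_bounded compact_continuous_image holomorphic_on_imp_continuous_on e) auto
  then obtain B where B: "0 < B" "\<And>z. z \<in> cball a e \<Longrightarrow> cmod (h z) \<le> B"
    by (auto simp: bounded_pos)
  define m where "m = zorder G a"
  define n where "n = nat \<bar>m\<bar>"
  show ?thesis
  proof (rule that[of "min e 1" B n])
    fix z assume z: "z \<noteq> a" "dist z a < min e 1"
    define t where "t = dist z a"
    have t: "0 < t" "t \<le> 1" using z by (auto simp: t_def)
    have "t powi m \<le> 1 / t ^ n"
    proof (cases "0 \<le> m")
      case True
      hence "t powi m = t ^ n" by (simp add: n_def power_int_def)
      also have "\<dots> \<le> 1" using t by (intro power_le_one) auto
      also have "1 \<le> 1 / t ^ n" using t by (simp add: power_le_one)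
      finally show ?thesis .
    next
      case False
      thus ?thesis by (simp add: n_def power_int_def divide_inverse power_inverse)
    qed
    moreover have "cmod (G z) = cmod (h z) * t powi m"
      using e(3)[of z] z by (simp add: m_def t_def norm_mult norm_power_int dist_norm norm_minus_commute)
    moreover have "cmod (h z) \<le> B" using z by (intro B) (auto simp: dist_commute)
    moreover have "0 \<le> t powi m" using t by simp
    ultimately have "cmod (G z) \<le> B * (1 / t ^ n)"
      using B(1) by (simp only:) (intro mult_mono; simp)
    thus "cmod (G z) \<le> B / dist z a ^ n" by (simp add: t_def)
  qed (use e B in auto)
next
  case False
  hence "\<forall>\<^sub>F z in at a. G z = 0" by (simp add: frequently_def)
  then obtain e where "0 < e" "\<And>z. z \<noteq> a \<Longrightarrow> dist z a < e \<Longrightarrow> G z = 0" by (auto simp: eventually_at)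
  thus ?thesis by (intro that[of e 1 0]) auto
qed

theorem theoremA:
  fixes r :: nat and \<rho> :: "real \<Rightarrow> real" and l :: real
  assumes "2 \<le> r"
    and "proximate_order \<rho>"
    and "(\<rho> \<longlongrightarrow> l) at_top"
    and "0 < l"
  shows "\<exists>g. g holomorphic_on ball 0 1 \<and>
           PF_fun r g \<and>
           has_proximate_order_disk g \<rho> \<and>
           (\<exists>G. G holomorphic_on (UNIV - {1}) \<and>
                analytic_at_infinity G \<and>
                (\<forall>z\<in>ball 0 1. G z = g z) \<and>
                essential_singularity_at G 1 \<and>
                has_singularity_of_proximate_order_at_1 G \<rho>)"
proof -
  define V where "V = prox_V \<rho>"
  obtain X where "regular_growth V (l / 2) (2 * l) X"
    using proximate_order_regular_growth[OF assms(2-4)] unfolding V_def by blast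
  then interpret regular_growth V "l / 2" "2 * l" X .
  have "1 \<le> r" using assms(1) by simp
  obtain b c C x0 where b: "PF_seq r b" "b 0 = 1" "\<And>k. 0 \<le> b k"
    "\<And>x. 0 \<le> x \<Longrightarrow> summable (\<lambda>k. b k * x ^ k)" and c: "0 < c" and x0: "X \<le> x0"
    and growth: "\<And>x. x0 \<le> x \<Longrightarrow> exp (c * V x) \<le> (\<Sum>k. b k * x ^ k)"
      "\<And>x. x0 \<le> x \<Longrightarrow> (\<Sum>k. b k * x ^ k) \<le> exp (C * V x)"
    by (rule entire_PF_function_of_growth[OF \<open>1 \<le> r\<close>]) blast
  define \<phi> where "\<phi> x = (\<Sum>k. b k * x ^ k)" for x :: real
  define \<psi> where "\<psi> v = (\<Sum>k. of_real (b k) * v ^ k)" for v :: complex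
  define G where "G z = \<psi> (z / (1 - z)) / (1 - z) ^ r" for z

  have norm_term: "norm (of_real (b k) * v ^ k) = b k * norm v ^ k" for k and v :: complex
    using b(3)[of k] by (simp add: norm_mult norm_power)
  have norm_summable: "summable (\<lambda>k. norm (of_real (b k) * v ^ k))" for v :: complex
    unfolding norm_term by (rule b(4)) simp
  have \<psi>_sums: "(\<lambda>k. of_real (b k) * v ^ k) sums \<psi> v" for v
    unfolding \<psi>_def by (rule summable_sums[OF summable_norm_cancel[OF norm_summable]])
  have \<psi>_of_real: "\<psi> (of_real x) = of_real (\<phi> x)" if "0 \<le> x" for x
  proof -
    have "(\<lambda>k. complex_of_real (b k * x ^ k)) sums of_real (\<phi> x)"
      unfolding \<phi>_def by (intro sums_of_real summable_sums b(4) that)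
    thus ?thesis using \<psi>_sums[of "of_real x"] by (auto dest: sums_unique2)
  qed
  have \<psi>_norm: "norm (\<psi> v) \<le> \<phi> (norm v)" for v
    unfolding \<psi>_def \<phi>_def using summable_norm[OF norm_summable[of v]] by (simp only: norm_term)
  have \<phi>_mono: "\<phi> x \<le> \<phi> y" if "0 \<le> x" "x \<le> y" for x y
    unfolding \<phi>_def using that by (intro suminf_le b(4) mult_left_mono power_mono b(3)) auto
  have \<phi>_ge_1: "1 \<le> \<phi> x" if "0 \<le> x" for x
  proof -
    have "(\<Sum>k\<in>{0}. b k * x ^ k) \<le> \<phi> x"
      unfolding \<phi>_def by (rule sum_le_suminf[OF b(4)[OF that]]) (use b(3) that in auto)
    thus ?thesis by (simp add: b(2))
  qed
  have \<psi>_holo: "\<psi> holomorphic_on S" for S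
  proof -
    have "\<psi> field_differentiable (at v)" for v
    proof -
      have "\<psi> holomorphic_on ball 0 (norm v + 1)"
        by (rule power_series_holomorphic[where a = "\<lambda>k. of_real (b k)"]) (use \<psi>_sums in simp)
      thus ?thesis by (rule holomorphic_on_imp_differentiable_at) auto
    qed
    thus ?thesis by (auto simp: holomorphic_on_def intro: field_differentiable_at_within)
  qed
  have G_holo: "G holomorphic_on S" if "1 \<notin> S" for S
  proof -
    have "(\<lambda>z. z / (1 - z)) holomorphic_on S"
      by (intro holomorphic_intros) (use that in auto)
    hence "(\<psi> \<circ> (\<lambda>z. z / (1 - z))) holomorphic_on S"
      by (rule holomorphic_on_compose[OF _ \<psi>_holo])
    hence "(\<lambda>z. \<psi> (z / (1 - z))) holomorphic_on S" by (simp add: o_def)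
    thus ?thesis unfolding G_def by (intro holomorphic_intros) (use that in auto)
  qed

  \<comment> \<open>At \<open>1 - 1 / x\<close> one has \<open>w = x\<close>, and \<open>\<psi>\<close> agrees with \<open>\<phi>\<close> on non-negative numbers.\<close>
  have G_real: "cmod (G (of_real (1 - 1 / x))) = x ^ r * \<phi> (x - 1)" if "1 \<le> x" for x
  proof -
    have e: "1 - complex_of_real (1 - 1 / x) = of_real (1 / x)" by simp
    have "(1 - 1 / x) / (1 / x) = x - 1" using that by (simp add: field_simps)
    hence q: "complex_of_real (1 - 1 / x) / of_real (1 / x) = of_real (x - 1)" by (metis of_real_divide)
    have "G (of_real (1 - 1 / x)) = \<psi> (of_real (x - 1)) / of_real (1 / x) ^ r" by (simp only: G_def e q)
    also have "\<dots> = of_real (\<phi> (x - 1)) / of_real (1 / x) ^ r" by (subst \<psi>_of_real) (use that in simp_all)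
    also have "\<dots> = of_real (\<phi> (x - 1) / (1 / x) ^ r)" by (simp only: of_real_divide of_real_power)
    also have "\<phi> (x - 1) / (1 / x) ^ r = x ^ r * \<phi> (x - 1)" using that by (simp add: power_divide)
    finally show ?thesis using \<phi>_ge_1[of "x - 1"] that by (simp only: norm_of_real) simp
  qed
  have G_bound: "cmod (G z) \<le> x ^ r * \<phi> y"
    if "z \<noteq> 1" "1 / cmod (1 - z) \<le> x" "cmod (z / (1 - z)) \<le> y" for x y z
  proof -
    have "0 \<le> 1 / cmod (1 - z)" by simp
    hence x: "0 \<le> x" using that(2) by linarith
    have "cmod (G z) = cmod (\<psi> (z / (1 - z))) * (1 / cmod (1 - z)) ^ r"
      by (simp add: G_def norm_divide norm_power power_divide)
    also have "\<dots> \<le> \<phi> y * x ^ r"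
    proof (intro mult_mono power_mono)
      have "cmod (\<psi> (z / (1 - z))) \<le> \<phi> (cmod (z / (1 - z)))" by (rule \<psi>_norm)
      also have "\<dots> \<le> \<phi> y" by (rule \<phi>_mono[OF _ that(3)]) simp
      finally show "cmod (\<psi> (z / (1 - z))) \<le> \<phi> y" .
      show "0 \<le> \<phi> y" using \<phi>_ge_1[of y] order_trans[OF norm_ge_zero that(3)] by simp
    qed (use that x in auto)
    finally show ?thesis by (simp add: mult.commute)
  qed

  \<comment> \<open>The lower bound is used at \<open>w - 1 = x - 1\<close>, the upper bound at \<open>\<bar>w - 1\<bar> \<le> x + 1\<close>; by \<open>V_double\<close> the shift only changes constants.\<close>
  define c' where "c' = c * 2 powr (- (2 * l))"
  define C' where "C' = real r + \<bar>C\<bar> * 2 powr (2 * l)"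
  have c': "0 < c'" using c by (simp add: c'_def)
  have lower: "\<forall>\<^sub>F x in at_top. c' * V x \<le> ln (x ^ r * \<phi> (x - 1))"
    using eventually_ge_at_top[of "x0 + 2"]
  proof eventually_elim
    case (elim x)
    have x: "X \<le> x - 1" "x \<le> 2 * (x - 1)" "1 \<le> x" using elim x0 X by auto
    have "V x \<le> V (x - 1) * 2 powr (2 * l)" using x by (intro V_double) auto
    hence "c' * V x \<le> c * V (x - 1)"
      using c by (simp add: c'_def powr_minus field_simps)
    also have "\<dots> \<le> ln (\<phi> (x - 1))"
      using growth(1)[of "x - 1"] elim \<phi>_ge_1[of "x - 1"] x by (simp add: ln_ge_iff \<phi>_def)
    also have "\<dots> \<le> ln (x ^ r * \<phi> (x - 1))"
      using \<phi>_ge_1[of "x - 1"] x one_le_power[of x r]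
      by (subst ln_le_cancel_iff) (auto intro!: mult_pos_pos simp: mult_le_cancel_right1)
    finally show ?case .
  qed
  have "\<forall>\<^sub>F x in at_top. ln x / V x < 1" by (rule order_tendstoD[OF ln_negligible]) simp
  hence upper: "\<forall>\<^sub>F x in at_top. ln (x ^ r * \<phi> (x + 1)) \<le> C' * V x"
    using eventually_ge_at_top[of x0]
  proof eventually_elim
    case (elim x)
    have x: "X \<le> x" "1 \<le> x" using elim x0 X by auto
    have Vx: "0 < V x" using x V_pos by auto
    have \<phi>: "1 \<le> \<phi> (x + 1)" using x by (intro \<phi>_ge_1) auto
    have "ln (x ^ r * \<phi> (x + 1)) = real r * ln x + ln (\<phi> (x + 1))"
      using x \<phi> by (simp add: ln_mult ln_realpow)
    also have "ln (\<phi> (x + 1)) \<le> C * V (x + 1)"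
    proof -
      have "\<phi> (x + 1) \<le> exp (C * V (x + 1))" using growth(2)[of "x + 1"] elim by (simp add: \<phi>_def)
      hence "ln (\<phi> (x + 1)) \<le> ln (exp (C * V (x + 1)))" using \<phi> by (subst ln_le_cancel_iff) auto
      thus ?thesis by simp
    qed
    also have "\<dots> \<le> \<bar>C\<bar> * (V x * 2 powr (2 * l))"
      using V_double[of x "x + 1"] V_pos[of "x + 1"] x by (intro mult_mono) auto
    also have "real r * ln x \<le> real r * V x"
      using elim(1) Vx by (intro mult_left_mono) (auto simp: field_simps)
    finally show ?case by (simp add: C'_def algebra_simps)
  qed
  have V_ev: "\<forall>\<^sub>F x in at_top. 0 < V x" using eventually_ge_at_top[of X] by eventually_elim (rule V_pos)

  have disk: "has_proximate_order_disk G \<rho>"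
    unfolding has_proximate_order_disk_def
  proof (intro conjI Limsup_pos_finite)
    show "G holomorphic_on ball 0 1" by (rule G_holo) simp
    have "filterlim (\<lambda>y::real. 1 / (1 - y)) at_top (at_left 1)" by real_asymp
    hence "\<forall>\<^sub>F y in at_left 1. c' * V (1 / (1 - y)) \<le> ln ((1 / (1 - y)) ^ r * \<phi> (1 / (1 - y) - 1)) \<and>
        ln ((1 / (1 - y)) ^ r * \<phi> (1 / (1 - y) + 1)) \<le> C' * V (1 / (1 - y)) \<and> 0 < V (1 / (1 - y))"
      by (rule eventually_compose_filterlim[rotated]) (intro eventually_conj lower upper V_ev)
    moreover have "\<forall>\<^sub>F y in at_left (1::real). y \<in> {0<..<1}"
      by (rule eventually_at_leftI[of 0]) auto
    ultimately show "\<forall>\<^sub>F y in at_left (1::real).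
        c' \<le> ln (max_mod G (sphere 0 y)) / prox_V \<rho> (1 / (1 - y)) \<and>
        ln (max_mod G (sphere 0 y)) / prox_V \<rho> (1 / (1 - y)) \<le> C'"
    proof eventually_elim
      case (elim y)
      define x where "x = 1 / (1 - y)"
      have x: "1 \<le> x" "y = 1 - 1 / x" using elim by (auto simp: x_def)
      have bound: "cmod (G z) \<le> x ^ r * \<phi> (x - 1)" if "z \<in> sphere 0 y" for z
      proof -
        have z: "cmod z = y" using that by simp
        have le: "1 - y \<le> cmod (1 - z)" using norm_triangle_ineq2[of 1 z] z by simp
        moreover have "0 < 1 - y" using elim by simp
        ultimately have pos: "0 < cmod (1 - z) * (1 - y)" by (intro mult_pos_pos) auto
        have "1 / cmod (1 - z) \<le> x" unfolding x_def using le pos by (intro divide_left_mono) auto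
        moreover have "cmod (z / (1 - z)) \<le> y / (1 - y)"
          unfolding norm_divide z using le elim pos by (intro divide_left_mono) auto
        moreover have "y / (1 - y) = x - 1" using elim by (simp add: x_def field_simps)
        moreover have "z \<noteq> 1" using z elim by auto
        ultimately show ?thesis by (intro G_bound) auto
      qed
      have "complex_of_real y \<in> sphere 0 y" using elim by simp
      from max_mod_between[where g = G, OF this bound]
      have "max_mod G (sphere 0 y) = x ^ r * \<phi> (x - 1)"
        using G_real[OF x(1)] x(2) by simp
      moreover have "ln (x ^ r * \<phi> (x - 1)) \<le> ln (x ^ r * \<phi> (x + 1))"
        using \<phi>_ge_1[of "x - 1"] \<phi>_mono[of "x - 1" "x + 1"] x(1)
        by (subst ln_le_cancel_iff) (auto intro!: mult_pos_pos)
      ultimately show ?case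
        using elim by (simp add: V_def[symmetric] x_def[symmetric] le_divide_eq divide_le_eq)
    qed
  qed (use c' in auto)

  have singularity: "has_singularity_of_proximate_order_at_1 G \<rho>"
    unfolding has_singularity_of_proximate_order_at_1_def
  proof (intro exI[of _ 1] conjI Limsup_pos_finite)
    have "G analytic_on - {1}" by (subst analytic_on_open) (auto intro: G_holo)
    thus "G analytic_on {z. 0 < cmod (z - 1) \<and> cmod (z - 1) \<le> 1}"
      by (rule analytic_on_subset) auto
    show "\<forall>\<^sub>F x in at_top.
        c' \<le> ln (max_mod G {z. 1 / x \<le> cmod (z - 1) \<and> cmod (z - 1) \<le> 1}) / prox_V \<rho> x \<and>
        ln (max_mod G {z. 1 / x \<le> cmod (z - 1) \<and> cmod (z - 1) \<le> 1}) / prox_V \<rho> x \<le> C'"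
      using lower upper V_ev eventually_ge_at_top[of 1]
    proof eventually_elim
      case (elim x)
      define S where "S = {z. 1 / x \<le> cmod (z - 1) \<and> cmod (z - 1) \<le> 1}"
      have bound: "cmod (G z) \<le> x ^ r * \<phi> (x + 1)" if "z \<in> S" for z
      proof (rule G_bound)
        have le: "1 / x \<le> cmod (1 - z)" using that by (simp add: S_def norm_minus_commute)
        moreover have "0 < 1 / x" using elim by simp
        ultimately show z: "z \<noteq> 1" by auto
        show *: "1 / cmod (1 - z) \<le> x" using le z elim by (simp add: field_simps)
        have "z / (1 - z) = 1 / (1 - z) - 1" using z by (simp add: field_simps)
        also have "cmod \<dots> \<le> cmod (1 / (1 - z)) + cmod 1" by (rule norm_triangle_ineq4)
        also have "\<dots> \<le> x + 1" using * by (simp add: norm_divide)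
        finally show "cmod (z / (1 - z)) \<le> x + 1" .
      qed
      have "complex_of_real (1 - 1 / x) \<in> S" using elim by (simp add: S_def norm_divide)
      from max_mod_between[where g = G, OF this bound]
      have *: "x ^ r * \<phi> (x - 1) \<le> max_mod G S" "max_mod G S \<le> x ^ r * \<phi> (x + 1)"
        using G_real[of x] elim by auto
      have "0 < x ^ r * \<phi> (x - 1)" using \<phi>_ge_1[of "x - 1"] elim by (intro mult_pos_pos) auto
      with * have "ln (x ^ r * \<phi> (x - 1)) \<le> ln (max_mod G S)"
        "ln (max_mod G S) \<le> ln (x ^ r * \<phi> (x + 1))" by auto
      hence "c' \<le> ln (max_mod G S) / V x \<and> ln (max_mod G S) / V x \<le> C'"
        using elim by (simp add: le_divide_eq divide_le_eq)
      thus ?case by (simp only: V_def S_def)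
    qed
  qed (use c' in auto)

  have essential: "essential_singularity_at G 1"
    unfolding essential_singularity_at_def
  proof
    have "G analytic_on ball 1 1 - {1}" by (subst analytic_on_open) (auto intro: G_holo)
    thus iso: "isolated_singularity_at G 1"
      unfolding isolated_singularity_at_def by (intro exI[of _ 1]) auto
    show "\<not> not_essential G 1"
    proof
      assume "not_essential G 1"
      from not_essential_imp_polynomial_bound[OF iso this]
      obtain B n \<delta> where B: "0 < \<delta>" "0 < B"
        "\<And>z. z \<noteq> 1 \<Longrightarrow> dist z 1 < \<delta> \<Longrightarrow> cmod (G z) \<le> B / dist z 1 ^ n" by metis
      have "((\<lambda>x. ln B / V x + real n * (ln x / V x)) \<longlongrightarrow> 0 + real n * 0) at_top"
        by (intro tendsto_intros ln_negligible real_tendsto_divide_at_top[OF tendsto_const V_at_top])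
      hence "\<forall>\<^sub>F x in at_top. ln B / V x + real n * (ln x / V x) < c'"
        using c' by (intro order_tendstoD) auto
      moreover have "\<forall>\<^sub>F x in at_top. 1 / \<delta> < x" by (rule eventually_gt_at_top)
      ultimately have "\<forall>\<^sub>F x::real in at_top. False"
        using lower V_ev eventually_ge_at_top[of 1]
      proof eventually_elim
        case (elim x)
        define z where "z = complex_of_real (1 - 1 / x)"
        have x: "0 < x" using elim by simp
        have dist: "dist z 1 = 1 / x" using x by (simp add: z_def dist_norm norm_divide)
        have "1 / x < \<delta>" using elim x B(1) by (simp add: field_simps)
        moreover have "z \<noteq> 1" using x dist by auto
        ultimately have "cmod (G z) \<le> B / (1 / x) ^ n" using B(3)[of z] dist by simp
        also have "\<dots> = B * x ^ n" using x by (simp add: power_divide)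
        finally have "x ^ r * \<phi> (x - 1) \<le> B * x ^ n" using G_real[of x] elim by (simp add: z_def)
        moreover have "0 < x ^ r * \<phi> (x - 1)" using \<phi>_ge_1[of "x - 1"] elim by (intro mult_pos_pos) auto
        ultimately have "ln (x ^ r * \<phi> (x - 1)) \<le> ln (B * x ^ n)" by simp
        also have "\<dots> = ln B + real n * ln x" using B(2) x by (simp add: ln_mult ln_realpow)
        finally have "c' * V x \<le> ln B + real n * ln x" using elim by linarith
        moreover have "ln B + real n * ln x < c' * V x" using elim by (simp add: field_simps)
        ultimately show False by linarith
      qed
      thus False by simp
    qed
  qed

  have infinity: "analytic_at_infinity G"
    unfolding analytic_at_infinity_def
  proof (intro exI[of _ "\<lambda>u. \<psi> (1 / (u - 1)) * (u / (u - 1)) ^ r"] conjI)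
    have "(\<lambda>u. 1 / (u - 1)) holomorphic_on ball (0 :: complex) 1"
      by (intro holomorphic_intros) auto
    hence "(\<psi> \<circ> (\<lambda>u. 1 / (u - 1))) holomorphic_on ball 0 1"
      by (rule holomorphic_on_compose[OF _ \<psi>_holo])
    hence "(\<lambda>u. \<psi> (1 / (u - 1))) holomorphic_on ball 0 1" by (simp add: o_def)
    hence "(\<lambda>u. \<psi> (1 / (u - 1)) * (u / (u - 1)) ^ r) holomorphic_on ball 0 1"
      by (intro holomorphic_intros) auto
    hence "(\<lambda>u. \<psi> (1 / (u - 1)) * (u / (u - 1)) ^ r) analytic_on ball 0 1"
      by (simp add: analytic_on_open)
    thus "(\<lambda>u. \<psi> (1 / (u - 1)) * (u / (u - 1)) ^ r) analytic_on {0}"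
      by (rule analytic_on_subset) auto
    have "\<psi> (1 / (u - 1)) * (u / (u - 1)) ^ r = G (inverse u)" if "u \<noteq> 0" "dist u 0 < 1" for u
    proof -
      have u: "u \<noteq> 0" "u - 1 \<noteq> 0" using that by auto
      have quot: "inverse u / (1 - inverse u) = 1 / (u - 1)" using u by (simp add: field_simps)
      have diff: "1 - inverse u = (u - 1) / u" using u by (simp add: field_simps)
      have "G (inverse u) = \<psi> (1 / (u - 1)) / ((u - 1) / u) ^ r" unfolding G_def quot unfolding diff ..
      thus ?thesis by (simp add: power_divide)
    qed
    thus "\<forall>\<^sub>F u in at 0. \<psi> (1 / (u - 1)) * (u / (u - 1)) ^ r = G (inverse u)"
      unfolding eventually_at by (intro exI[of _ 1]) auto
  qed

  have "PF_fun r G"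
    unfolding PF_fun_def
  proof (intro exI[of _ "binomial_transform (r - 1) b"] conjI ballI)
    have r: "Suc (r - 1) = r" using assms(1) by simp
    show "PF_seq r (binomial_transform (r - 1) b)"
      using PF_seq_binomial_transform[of "r - 1" b, unfolded r] b(1,2) by simp
    fix z :: complex assume "z \<in> ball 0 1"
    hence "norm z < 1" by simp
    from binomial_transform_sums[OF b(3,4) this, of "r - 1"]
    show "(\<lambda>k. of_real (binomial_transform (r - 1) b k) * z ^ k) sums G z"
      by (simp only: r G_def \<psi>_def)
  qed
  thus ?thesis
    using disk singularity essential infinity G_holo[of "ball 0 1"] G_holo[of "UNIV - {1}"]
    by (intro exI[of _ G]) auto
qed

end
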